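(* For $m\in(0,\tfrac12]$, choose the integer $N\ge1$ with $m\in(\tfrac1{2N+2},\tfrac1{2N}]$, let $\ell\in\{\tfrac1{2N+2},\tfrac1{2N}\}$ be an endpoint nearest to $m$, put $\Delta_m=|m-\ell|$, and define $$V_{\min}(m)=\frac{2\Delta_m^{3/2}}{3\sqrt{N(N+1)}}-\Delta_m^2,\qquad V_{\min}(0)=0.$$ Then the following hold. (i) For all random variables $U,V$ on a common probability space with $U,V\sim\mathcal U(0,1)$ and $m=\mathbb E|U-V|$, $$\mathbb E(U-V)^2\ge m^2+V_{\min}(m).$$ (ii) The bound in (i) is sharp for every $m\in[0,\tfrac12]$: for $m>0$ it is attained (equality holds) for $(U,V)\sim C_x$ with $x=1-3m$, where $C_x$ is the copula constructed in the context, and for $m=0$ it is attained by the comonotonicity copula $M(u,v)=\min\{u,v\}$. (iii) $V_{\min}(m)\ge0$, and $V_{\min}(m)=0$ if and only if $m\in\mathfrak C:=\{0\}\cup\{\tfrac1{2N}: N\in\mathbb N\}$, where $\mathbb N=\{1,2,\dots\}$.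
   Context: A bivariate copula is a bivariate distribution function $C$ on $[0,1]^2$ with uniform margins; $(U,V)\sim C$ means that $(U,V)$ has joint distribution function $C$. $\mathcal U(0,1)$ is the uniform distribution on $[0,1]$. Note $\mathbb E|U-V|\in[0,\tfrac12]$ whenever $U,V\sim\mathcal U(0,1)$. Construction of $C_x$ for $x\in[-\tfrac12,1)$. Let $\lambda$ be Lebesgue measure on $[0,1]$, $\lambda|_I$ its restriction to an interval $I$, $F_\#\mu$ the pushforward of $\mu$ under $F$, and $S(u,v)=(v,u)$. Let $m=\tfrac{1-x}3$, let $N\ge1$ be the unique integer with $x\in I_N=[1-\tfrac3{2N},1-\tfrac3{2N+2})$, and put $R=\tfrac1{2N+2}$, $L=\tfrac1{2N}$, $d_N=\tfrac1{L-R}=2N(N+1)$, $I_N^L=[1-3L,\,1-\tfrac32(L+R))$, $I_N^R=[1-\tfrac32(L+R),\,1-3R)$. Put $v=\sqrt{2(L-m)/d_N}$ and $\theta=2L-v$ if $x\in I_N^L$; $v=\sqrt{2(m-R)/d_N}$ and $\theta=2R+v$ if $x\in I_N^R$; and $p=1-d_Nv$ in both cases. Let $\alpha_k=1-\tfrac kN$, $\beta_k=\tfrac{k+1}N$, $\ell_L(t)=L-v+\tfrac tN$, $\ell_R(t)=R+\tfrac tN$. Define, for $0\le t\le Nv$ and $0\le s\le pL$ (resp. $0\le s\le pR$), $A_k^L(s)=(k\theta+Nv+s,\;k\theta+Nv+s+L)$, $B_k^L(t)=(k\theta+t,\;k\theta+t+\ell_L(t))$, $C_k^L(t)=(k\theta+t+\ell_L(t),\;(k+1)\theta+t)$,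 $A_k^R(s)=(k\theta+s,\;k\theta+s+R)$, $B_k^R(t)=(k\theta+pR+t,\;k\theta+pR+t+\ell_R(t))$, $C_k^R(t)=(k\theta+pR+t+\ell_R(t),\;(k+1)\theta+pR+t)$. For $x\in I_N^L$ let $$\nu_x=\sum_{k=0}^{N-1}(A_k^L)_\#(\lambda|_{[0,pL]})+\sum_{k=0}^{N-1}\alpha_k(B_k^L)_\#(\lambda|_{[0,Nv]})+\sum_{k=0}^{N-1}\beta_k(C_k^L)_\#(\lambda|_{[0,Nv]}),$$ and for $x\in I_N^R$ let $$\nu_x=\sum_{k=0}^{N}(A_k^R)_\#(\lambda|_{[0,pR]})+\sum_{k=0}^{N-1}\alpha_k(B_k^R)_\#(\lambda|_{[0,Nv]})+\sum_{k=0}^{N-1}\beta_k(C_k^R)_\#(\lambda|_{[0,Nv]}).$$ Set $\pi_x=\nu_x+S_\#\nu_x$ (a probability measure on $[0,1]^2$ with uniform marginals) and $C_x(u,v)=\pi_x([0,u]\times[0,v])$. *)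

theory Defs
  imports "HOL-Probability.Probability"
begin

section \<open>Copulas and random variables with uniform margins\<close>

definition uniform01 :: "'a measure \<Rightarrow> ('a \<Rightarrow> real) \<Rightarrow> bool" where
  "uniform01 \<Omega> U \<longleftrightarrow>
     U \<in> borel_measurable \<Omega> \<and> distr \<Omega> borel U = uniform_measure lborel {0..1}"

text \<open>Only the values of a copula on the unit square are meaningful; a function on the square is
  represented by a function on the plane whose values elsewhere are ignored.\<close>

definition is_copula :: "(real \<Rightarrow> real \<Rightarrow> real) \<Rightarrow> bool" where
  "is_copula C \<longleftrightarrow>
     (\<exists>\<mu> :: (real \<times> real) measure.
        prob_space \<mu> \<and> sets \<mu> = sets borel \<and> uniform01 \<mu> fst \<and> uniform01 \<mu> snd \<and>
        (\<forall>u\<in>{0..1}. \<forall>v\<in>{0..1}. C u v = measure \<mu> ({..u} \<times> {..v})))"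

text \<open>\<open>(U, V) \<sim> C\<close>.  For a copula \<open>C\<close> the values on the unit square determine the joint law,
  since \<open>C 1 1 = 1\<close> and \<open>C 0 1 = C 1 0 = 0\<close>.\<close>

definition has_copula ::
  "'a measure \<Rightarrow> ('a \<Rightarrow> real) \<Rightarrow> ('a \<Rightarrow> real) \<Rightarrow> (real \<Rightarrow> real \<Rightarrow> real) \<Rightarrow> bool" where
  "has_copula \<Omega> U V C \<longleftrightarrow>
     prob_space \<Omega> \<and> U \<in> borel_measurable \<Omega> \<and> V \<in> borel_measurable \<Omega> \<and>
     (\<forall>u\<in>{0..1}. \<forall>v\<in>{0..1}. measure \<Omega> {\<omega> \<in> space \<Omega>. U \<omega> \<le> u \<and> V \<omega> \<le> v} = C u v)"

definition comonotonicity_copula :: "real \<Rightarrow> real \<Rightarrow> real" where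
  "comonotonicity_copula u v = min u v"

section \<open>The lower bound\<close>

definition Vmin_index :: "real \<Rightarrow> nat" where
  "Vmin_index m =
     (THE N. N \<ge> 1 \<and> m \<in> {1 / (2 * real N + 2) <.. 1 / (2 * real N)})"

definition nearest_endpoint :: "real \<Rightarrow> real" where
  "nearest_endpoint m =
     arg_min_on (\<lambda>l. \<bar>m - l\<bar>)
       {1 / (2 * real (Vmin_index m) + 2), 1 / (2 * real (Vmin_index m))}"

definition Delta :: "real \<Rightarrow> real" where
  "Delta m = \<bar>m - nearest_endpoint m\<bar>"

definition Vmin :: "real \<Rightarrow> real" where
  "Vmin m =
     (if m = 0 then 0
      else 2 * Delta m powr (3/2) / (3 * sqrt (real (Vmin_index m) * (real (Vmin_index m) + 1)))
           - (Delta m)\<^sup>2)"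

definition crit_set :: "real set" where
  "crit_set = {0} \<union> {1 / (2 * real N) | N :: nat. N \<ge> 1}"

section \<open>Finite sums of Borel measures\<close>

definition add_measure ::
  "'a::topological_space measure \<Rightarrow> 'a measure \<Rightarrow> 'a measure" where
  "add_measure \<mu> \<nu> = measure_of UNIV (sets borel) (\<lambda>A. emeasure \<mu> A + emeasure \<nu> A)"

definition sum_measure ::
  "('i \<Rightarrow> 'a::topological_space measure) \<Rightarrow> 'i set \<Rightarrow> 'a measure" where
  "sum_measure \<mu> I = measure_of UNIV (sets borel) (\<lambda>A. \<Sum>i\<in>I. emeasure (\<mu> i) A)"

text \<open>\<open>measure_of\<close> yields the null measure if the set function is not countably additive; the
  following lemmas show that this does not happen for Borel measures.\<close>

lemma sets_add_measure [simp]: "sets (add_measure \<mu> \<nu>) = sets borel"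
  unfolding add_measure_def by (metis sets.sets_measure_of_eq space_borel)

lemma sets_sum_measure [simp]: "sets (sum_measure \<mu> I) = sets borel"
  unfolding sum_measure_def by (metis sets.sets_measure_of_eq space_borel)

lemma emeasure_add_measure:
  assumes "sets \<mu> = sets borel" "sets \<nu> = sets borel" "A \<in> sets borel"
  shows "emeasure (add_measure \<mu> \<nu>) A = emeasure \<mu> A + emeasure \<nu> A"
proof (rule emeasure_measure_of[OF add_measure_def])
  show "countably_additive (sets (add_measure \<mu> \<nu>)) (\<lambda>A. emeasure \<mu> A + emeasure \<nu> A)"
    using assms by (auto intro!: countably_additiveI simp: suminf_add[symmetric] suminf_emeasure)
qed (use assms in \<open>auto simp: positive_def\<close>)

lemma emeasure_sum_measure:
  assumes "\<And>i. i \<in> I \<Longrightarrow> sets (\<mu> i) = sets borel" "A \<in> sets borel"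
  shows "emeasure (sum_measure \<mu> I) A = (\<Sum>i\<in>I. emeasure (\<mu> i) A)"
proof (rule emeasure_measure_of[OF sum_measure_def])
  show "countably_additive (sets (sum_measure \<mu> I)) (\<lambda>A. \<Sum>i\<in>I. emeasure (\<mu> i) A)"
  proof (rule countably_additiveI)
    fix F :: "nat \<Rightarrow> 'b set"
    assume F: "range F \<subseteq> sets (sum_measure \<mu> I)" "disjoint_family F"
    have "(\<Sum>n. \<Sum>i\<in>I. emeasure (\<mu> i) (F n)) = (\<Sum>i\<in>I. \<Sum>n. emeasure (\<mu> i) (F n))"
      by (rule suminf_sum) auto
    also have "\<dots> = (\<Sum>i\<in>I. emeasure (\<mu> i) (\<Union> (range F)))"
      using F assms(1) by (intro sum.cong refl suminf_emeasure) auto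
    finally show "(\<Sum>n. \<Sum>i\<in>I. emeasure (\<mu> i) (F n)) = (\<Sum>i\<in>I. emeasure (\<mu> i) (\<Union> (range F)))" .
  qed
qed (use assms in \<open>auto simp: positive_def\<close>)

section \<open>The copulas \<open>C\<^sub>x\<close>\<close>

text \<open>All parameters are functions of \<open>x\<close> and are meant for \<open>-1/2 \<le> x < 1\<close>.\<close>

definition cx_m :: "real \<Rightarrow> real" where
  "cx_m x = (1 - x) / 3"

definition cx_N :: "real \<Rightarrow> nat" where
  "cx_N x =
     (THE N. N \<ge> 1 \<and> x \<in> {1 - 3 / (2 * real N) ..< 1 - 3 / (2 * real N + 2)})"

definition cx_R :: "real \<Rightarrow> real" where
  "cx_R x = 1 / (2 * real (cx_N x) + 2)"

definition cx_L :: "real \<Rightarrow> real" where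
  "cx_L x = 1 / (2 * real (cx_N x))"

definition cx_d :: "real \<Rightarrow> real" where
  "cx_d x = 1 / (cx_L x - cx_R x)"

text \<open>The half \<open>I\<^sub>N\<^sup>L\<close> of \<open>I\<^sub>N\<close>, for \<open>N = cx_N x\<close>; its complement in \<open>I\<^sub>N\<close> is \<open>I\<^sub>N\<^sup>R\<close>.\<close>

definition cx_left :: "real \<Rightarrow> bool" where
  "cx_left x \<longleftrightarrow> x \<in> {1 - 3 * cx_L x ..< 1 - 3/2 * (cx_L x + cx_R x)}"

definition cx_v :: "real \<Rightarrow> real" where
  "cx_v x =
     (if cx_left x then sqrt (2 * (cx_L x - cx_m x) / cx_d x)
      else sqrt (2 * (cx_m x - cx_R x) / cx_d x))"

definition cx_theta :: "real \<Rightarrow> real" where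
  "cx_theta x = (if cx_left x then 2 * cx_L x - cx_v x else 2 * cx_R x + cx_v x)"

definition cx_p :: "real \<Rightarrow> real" where
  "cx_p x = 1 - cx_d x * cx_v x"

definition cx_alpha :: "real \<Rightarrow> nat \<Rightarrow> real" where
  "cx_alpha x k = 1 - real k / real (cx_N x)"

definition cx_beta :: "real \<Rightarrow> nat \<Rightarrow> real" where
  "cx_beta x k = (real k + 1) / real (cx_N x)"

definition cx_ell_L :: "real \<Rightarrow> real \<Rightarrow> real" where
  "cx_ell_L x t = cx_L x - cx_v x + t / real (cx_N x)"

definition cx_ell_R :: "real \<Rightarrow> real \<Rightarrow> real" where
  "cx_ell_R x t = cx_R x + t / real (cx_N x)"

definition cx_A_L :: "real \<Rightarrow> nat \<Rightarrow> real \<Rightarrow> real \<times> real" where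
  "cx_A_L x k s =
     (real k * cx_theta x + real (cx_N x) * cx_v x + s,
      real k * cx_theta x + real (cx_N x) * cx_v x + s + cx_L x)"

definition cx_B_L :: "real \<Rightarrow> nat \<Rightarrow> real \<Rightarrow> real \<times> real" where
  "cx_B_L x k t =
     (real k * cx_theta x + t,
      real k * cx_theta x + t + cx_ell_L x t)"

definition cx_C_L :: "real \<Rightarrow> nat \<Rightarrow> real \<Rightarrow> real \<times> real" where
  "cx_C_L x k t =
     (real k * cx_theta x + t + cx_ell_L x t,
      (real k + 1) * cx_theta x + t)"

definition cx_A_R :: "real \<Rightarrow> nat \<Rightarrow> real \<Rightarrow> real \<times> real" where
  "cx_A_R x k s =
     (real k * cx_theta x + s,
      real k * cx_theta x + s + cx_R x)"

definition cx_B_R :: "real \<Rightarrow> nat \<Rightarrow> real \<Rightarrow> real \<times> real" where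
  "cx_B_R x k t =
     (real k * cx_theta x + cx_p x * cx_R x + t,
      real k * cx_theta x + cx_p x * cx_R x + t + cx_ell_R x t)"

definition cx_C_R :: "real \<Rightarrow> nat \<Rightarrow> real \<Rightarrow> real \<times> real" where
  "cx_C_R x k t =
     (real k * cx_theta x + cx_p x * cx_R x + t + cx_ell_R x t,
      (real k + 1) * cx_theta x + cx_p x * cx_R x + t)"

text \<open>The pushforward \<open>F\<^sub># (\<lambda>|\<^bsub>[0,b]\<^esub>)\<close>, as a Borel measure on the plane.\<close>

definition push_leb :: "(real \<Rightarrow> real \<times> real) \<Rightarrow> real \<Rightarrow> (real \<times> real) measure" where
  "push_leb F b = distr (restrict_space lborel {0..b}) borel F"

definition cx_nu_L :: "real \<Rightarrow> (real \<times> real) measure" where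
  "cx_nu_L x =
     add_measure
       (add_measure
         (sum_measure (\<lambda>k. push_leb (cx_A_L x k) (cx_p x * cx_L x)) {0..<cx_N x})
         (sum_measure (\<lambda>k. scale_measure (ennreal (cx_alpha x k))
            (push_leb (cx_B_L x k) (real (cx_N x) * cx_v x))) {0..<cx_N x}))
       (sum_measure (\<lambda>k. scale_measure (ennreal (cx_beta x k))
          (push_leb (cx_C_L x k) (real (cx_N x) * cx_v x))) {0..<cx_N x})"

definition cx_nu_R :: "real \<Rightarrow> (real \<times> real) measure" where
  "cx_nu_R x =
     add_measure
       (add_measure
         (sum_measure (\<lambda>k. push_leb (cx_A_R x k) (cx_p x * cx_R x)) {0..cx_N x})
         (sum_measure (\<lambda>k. scale_measure (ennreal (cx_alpha x k))
            (push_leb (cx_B_R x k) (real (cx_N x) * cx_v x))) {0..<cx_N x}))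
       (sum_measure (\<lambda>k. scale_measure (ennreal (cx_beta x k))
          (push_leb (cx_C_R x k) (real (cx_N x) * cx_v x))) {0..<cx_N x})"

definition cx_nu :: "real \<Rightarrow> (real \<times> real) measure" where
  "cx_nu x = (if cx_left x then cx_nu_L x else cx_nu_R x)"

definition cx_pi :: "real \<Rightarrow> (real \<times> real) measure" where
  "cx_pi x = add_measure (cx_nu x) (distr (cx_nu x) borel prod.swap)"

definition Cx :: "real \<Rightarrow> real \<Rightarrow> real \<Rightarrow> real" where
  "Cx x u v = measure (cx_pi x) ({0..u} \<times> {0..v})"

end

theory Submission
  imports Defs
begin

text \<open>The bound is linear programming duality for an optimal transport problem.  For a coupling with mean
distance \<open>m\<close> and any number \<open>a\<close>,
\<open>E (U - V)\<^sup>2 = E (\<bar>U - V\<bar> - a)\<^sup>2 + 2 a m - a\<^sup>2\<close>,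
so it suffices to minimise the expected cost \<open>(\<bar>s - t\<bar> - a)\<^sup>2\<close> of a pair \<open>(s, t)\<close> over all couplings of two uniform
variables, for one well-chosen \<open>a\<close>.  The right choice is half the period \<open>\<theta>\<close> of the
construction.  The proof exhibits a function \<open>f\<close> with
\<open>f s + f t \<le> (\<bar>s - t\<bar> - a)\<^sup>2\<close> for all \<open>s\<close> and \<open>t\<close> (\<open>dual_potential_feasible\<close>),
with equality on the support of \<open>\<pi>\<^sub>x\<close> (\<open>coupling_tight\<close>).
As \<open>U\<close> and \<open>V\<close> are uniform, \<open>E (f U + f V)\<close> is the same for all couplings; hence it bounds every cost
from below and equals the cost of \<open>\<pi>\<^sub>x\<close> (\<open>coupling_optimal_shifted\<close>).

Equality on the support prescribes the derivative of \<open>f\<close>, and thereby \<open>f\<close>: it has period \<open>2 a\<close> and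
alternates between downward parabolas of curvature \<open>-2/N\<close> (caps) and upward parabolas of curvature
\<open>2/(N + 1)\<close> (cups), joined by lines of slope \<open>\<plusminus>v\<close>.  The inequality is first reduced to half a period, by
folding the line with the distance to a lattice, which brings no two points further apart
(\<open>fold_wave_lipschitz\<close>).  There it rests on the fact that \<open>w\<^sup>2/(N + 1)\<close> is the infimal
convolution of \<open>y\<^sup>2/N\<close> with \<open>y\<^sup>2\<close> (\<open>parabola_inf_convolution\<close>).

The two halves of \<open>I\<^sub>N\<close> differ only in where the periodic picture is cut off, so one locale
\<open>ladder\<close> describes both.  Its margins are uniform because the pieces tile the unit interval
(\<open>half_coupling_margins\<close>), and the distance has an explicit law, an atom and a uniform part, from which the two
moments follow (\<open>coupling_mean\<close>, \<open>coupling_second_moment\<close>).  Since a copula determines the joint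
law (\<open>joint_law_unique\<close>), these moments are those of every \<open>(U, V) \<sim> C\<^sub>x\<close>.  The sign of the excess is
elementary, once it is written as a product (\<open>Vmin_nonneg_and_zero_iff\<close>).\<close>

section \<open>Integration against finite sums of Borel measures\<close>

lemma borel_measurable_of_sets_eq:
  "f \<in> borel_measurable borel \<Longrightarrow> sets M = sets borel \<Longrightarrow> f \<in> borel_measurable M"
  using measurable_cong_sets[of M borel borel borel] by simp

lemma nn_integral_sum_measure:
  assumes "finite I" and sets: "\<And>i. i \<in> I \<Longrightarrow> sets (\<mu> i) = sets borel"
    and f: "f \<in> borel_measurable borel"
  shows "(\<integral>\<^sup>+x. f x \<partial>sum_measure \<mu> I) = (\<Sum>i\<in>I. \<integral>\<^sup>+x. f x \<partial>\<mu> i)"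
  using f
proof (induction f rule: borel_measurable_induct)
  case (cong f g)
  then have "f = g" by (simp add: fun_eq_iff)
  then show ?case using cong by simp
next
  case (set A)
  then show ?case
    using sets by (simp add: emeasure_sum_measure)
next
  case (mult u c)
  have *: "(\<integral>\<^sup>+x. c * u x \<partial>M) = c * (\<integral>\<^sup>+x. u x \<partial>M)" if "sets M = sets borel" for M
    by (rule nn_integral_cmult[OF borel_measurable_of_sets_eq[OF mult(2) that]])
  then show ?case
    using mult.IH sets by (simp add: sum_distrib_left)
next
  case (add u v)
  have *: "(\<integral>\<^sup>+x. v x + u x \<partial>M) = (\<integral>\<^sup>+x. v x \<partial>M) + (\<integral>\<^sup>+x. u x \<partial>M)" if "sets M = sets borel" for M
    by (rule nn_integral_add[OF add(3)[THEN borel_measurable_of_sets_eq, OF that]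
          add(1)[THEN borel_measurable_of_sets_eq, OF that]])
  then show ?case
    using add.IH sets by (simp add: sum.distrib)
next
  case (seq U)
  have mono: "(\<integral>\<^sup>+x. (SUP n. U n) x \<partial>M) = (SUP n. \<integral>\<^sup>+x. U n x \<partial>M)" if "sets M = sets borel" for M
  proof -
    have "(\<integral>\<^sup>+x. (SUP n. U n x) \<partial>M) = (SUP n. \<integral>\<^sup>+x. U n x \<partial>M)"
      by (rule nn_integral_monotone_convergence_SUP[OF \<open>incseq U\<close> borel_measurable_of_sets_eq[OF seq(1) that]])
    then show ?thesis by (simp add: image_comp)
  qed
  have "(SUP n. \<Sum>i\<in>I. \<integral>\<^sup>+x. U n x \<partial>\<mu> i) = (\<Sum>i\<in>I. SUP n. \<integral>\<^sup>+x. U n x \<partial>\<mu> i)"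
    using \<open>incseq U\<close>
    by (intro ennreal_SUP_sum) (auto simp: incseq_def le_fun_def intro!: nn_integral_mono)
  then have "(\<integral>\<^sup>+x. (SUP n. U n) x \<partial>sum_measure \<mu> I) = (\<Sum>i\<in>I. SUP n. \<integral>\<^sup>+x. U n x \<partial>\<mu> i)"
    unfolding mono[OF sets_sum_measure] by (simp add: seq.IH)
  also have "\<dots> = (\<Sum>i\<in>I. \<integral>\<^sup>+x. (SUP n. U n) x \<partial>\<mu> i)"
    using mono sets by (intro sum.cong) auto
  finally show ?case .
qed

lemma nn_integral_add_measure:
  assumes "sets \<mu> = sets borel" "sets \<nu> = sets borel" and f: "f \<in> borel_measurable borel"
  shows "(\<integral>\<^sup>+x. f x \<partial>add_measure \<mu> \<nu>) = (\<integral>\<^sup>+x. f x \<partial>\<mu>) + (\<integral>\<^sup>+x. f x \<partial>\<nu>)"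
proof -
  have "add_measure \<mu> \<nu> = sum_measure (\<lambda>i. if i then \<mu> else \<nu>) UNIV"
    by (rule measure_eqI)
      (use assms in \<open>auto simp: emeasure_add_measure emeasure_sum_measure UNIV_bool add.commute\<close>)
  then show ?thesis
    using assms by (simp add: nn_integral_sum_measure UNIV_bool add.commute)
qed

lemma sets_push_leb [simp]: "sets (push_leb F b) = sets borel"
  by (simp add: push_leb_def)

lemma nn_integral_push_leb:
  assumes [measurable]: "F \<in> borel_measurable borel" "f \<in> borel_measurable borel"
  shows "(\<integral>\<^sup>+z. f z \<partial>push_leb F b) = (\<integral>\<^sup>+t\<in>{0..b}. f (F t) \<partial>lborel)"
proof -
  have [measurable]: "F \<in> restrict_space lborel {0..b} \<rightarrow>\<^sub>M borel"
    by (intro measurable_restrict_space1) simp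
  show ?thesis
    unfolding push_leb_def
    by (subst nn_integral_distr) (auto simp: nn_integral_restrict_space)
qed

text \<open>The change of variables behind all marginals: an affine map with slope \<open>c\<close> carries
Lebesgue measure on an interval to \<open>1 / c\<close> times Lebesgue measure on the image interval.\<close>

lemma set_nn_integral_affine:
  fixes x c l :: real
  assumes [measurable]: "g \<in> borel_measurable borel" and c: "c > 0"
  shows "ennreal c * (\<integral>\<^sup>+t\<in>{0..l}. g (x + c * t) \<partial>lborel) = (\<integral>\<^sup>+y\<in>{x..x + c * l}. g y \<partial>lborel)"
proof -
  have "(\<integral>\<^sup>+y\<in>{x..x + c * l}. g y \<partial>lborel)
      = ennreal \<bar>c\<bar> * (\<integral>\<^sup>+t. g (x + c * t) * indicator {x..x + c * l} (x + c * t) \<partial>lborel)"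
    using c by (intro nn_integral_real_affine) auto
  also have "(\<integral>\<^sup>+t. g (x + c * t) * indicator {x..x + c * l} (x + c * t) \<partial>lborel)
      = (\<integral>\<^sup>+t\<in>{0..l}. g (x + c * t) \<partial>lborel)"
    using c by (intro nn_integral_cong) (auto simp: indicator_def zero_le_mult_iff)
  finally show ?thesis using c by simp
qed

lemma set_nn_integral_Icc_add:
  fixes x y z :: real
  assumes [measurable]: "g \<in> borel_measurable borel" and "x \<le> y" "y \<le> z"
  shows "(\<integral>\<^sup>+t\<in>{x..y}. g t \<partial>lborel) + (\<integral>\<^sup>+t\<in>{y..z}. g t \<partial>lborel) = (\<integral>\<^sup>+t\<in>{x..z}. g t \<partial>lborel)"
proof -
  have "(\<integral>\<^sup>+t\<in>{x..z}. g t \<partial>lborel)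
      = (\<integral>\<^sup>+t. g t * indicator {x..y} t + g t * indicator {y..z} t \<partial>lborel)"
  proof (rule nn_integral_cong_AE)
    show "AE t in lborel. g t * indicator {x..z} t = g t * indicator {x..y} t + g t * indicator {y..z} t"
      using AE_lborel_singleton[of y] by eventually_elim (use assms in \<open>auto simp: indicator_def\<close>)
  qed
  then show ?thesis by (simp add: nn_integral_add)
qed

section \<open>Uniform margins and joint laws\<close>

lemma uniform01_nn_integral:
  assumes "uniform01 \<Omega> U" and [measurable]: "g \<in> borel_measurable borel"
  shows "(\<integral>\<^sup>+\<omega>. g (U \<omega>) \<partial>\<Omega>) = (\<integral>\<^sup>+t\<in>{0..1}. g t \<partial>lborel)"
proof -
  have U [measurable]: "U \<in> borel_measurable \<Omega>" and d: "distr \<Omega> borel U = uniform_measure lborel {0..1}"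
    using assms by (auto simp: uniform01_def)
  have "(\<integral>\<^sup>+\<omega>. g (U \<omega>) \<partial>\<Omega>) = (\<integral>\<^sup>+t. g t \<partial>distr \<Omega> borel U)"
    by (simp add: nn_integral_distr)
  also have "\<dots> = (\<integral>\<^sup>+t\<in>{0..1}. g t \<partial>lborel)"
    unfolding d by (subst nn_integral_uniform_measure) (auto simp: divide_ennreal_def)
  finally show ?thesis .
qed

lemma uniform01I_nn_integral:
  assumes U [measurable]: "U \<in> borel_measurable \<Omega>"
    and I: "\<And>g. g \<in> borel_measurable borel \<Longrightarrow>
      (\<integral>\<^sup>+\<omega>. g (U \<omega>) \<partial>\<Omega>) = (\<integral>\<^sup>+t\<in>{0..1}. g t \<partial>lborel)"
  shows "uniform01 \<Omega> U"
  unfolding uniform01_def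
proof (intro conjI measure_eqI)
  fix A :: "real set" assume A: "A \<in> sets (distr \<Omega> borel U)"
  then have A' [measurable]: "A \<in> sets borel" by simp
  have "emeasure (distr \<Omega> borel U) A = (\<integral>\<^sup>+t. indicator A t \<partial>distr \<Omega> borel U)"
    by simp
  also have "\<dots> = (\<integral>\<^sup>+\<omega>. indicator A (U \<omega>) \<partial>\<Omega>)"
    by (subst nn_integral_distr) auto
  also have "\<dots> = (\<integral>\<^sup>+t\<in>{0..1}. indicator A t \<partial>lborel)"
    by (rule I) simp
  also have "\<dots> = (\<integral>\<^sup>+t. indicator A t \<partial>uniform_measure lborel {0..1})"
    by (subst nn_integral_uniform_measure) (auto simp: divide_ennreal_def)
  also have "\<dots> = emeasure (uniform_measure lborel {0..1}) A"
    by simp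
  finally show "emeasure (distr \<Omega> borel U) A = emeasure (uniform_measure lborel {0..1}) A" .
qed (auto simp: U)

lemma uniform01_prob_space:
  assumes "uniform01 \<Omega> U" shows "prob_space \<Omega>"
  using uniform01_nn_integral[OF assms, of "\<lambda>_. 1"] by (intro prob_spaceI) simp

lemma uniform01_AE:
  assumes "uniform01 \<Omega> U" shows "AE \<omega> in \<Omega>. 0 < U \<omega> \<and> U \<omega> \<le> 1"
proof -
  have [measurable]: "U \<in> borel_measurable \<Omega>" using assms by (simp add: uniform01_def)
  have "(\<integral>\<^sup>+\<omega>. indicator (- {0::real<..1}) (U \<omega>) \<partial>\<Omega>) = (\<integral>\<^sup>+t\<in>{0..1}. indicator (- {0::real<..1}) t \<partial>lborel)"
    by (rule uniform01_nn_integral[OF assms]) simp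
  also have "\<dots> = (\<integral>\<^sup>+(t::real). 0 \<partial>lborel)"
    by (rule nn_integral_cong_AE)
      (use AE_lborel_singleton[of "0::real"] in \<open>eventually_elim, auto simp: indicator_def\<close>)
  finally have "(\<integral>\<^sup>+\<omega>. indicator (- {0::real<..1}) (U \<omega>) \<partial>\<Omega>) = 0" by simp
  then have "AE \<omega> in \<Omega>. (indicator (- {0::real<..1}) (U \<omega>) :: ennreal) = 0"
    by (subst (asm) nn_integral_0_iff_AE) auto
  then show ?thesis
    by eventually_elim (auto simp: indicator_def split: if_splits)
qed

text \<open>For comparing couplings that live on different probability spaces, as the dual bound does.\<close>

lemma uniform01_integral_eq:
  fixes g :: "real \<Rightarrow> real"
  assumes "uniform01 \<Omega> U" "uniform01 \<Omega>' U'" and [measurable]: "g \<in> borel_measurable borel"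
  shows "(\<integral>\<omega>. g (U \<omega>) \<partial>\<Omega>) = (\<integral>\<omega>. g (U' \<omega>) \<partial>\<Omega>')"
proof -
  have [measurable]: "U \<in> borel_measurable \<Omega>" "U' \<in> borel_measurable \<Omega>'"
    and d: "distr \<Omega> borel U = distr \<Omega>' borel U'"
    using assms by (auto simp: uniform01_def)
  then show ?thesis
    by (metis assms(3) integral_distr)
qed

lemma uniform01_integrable_bounded:
  fixes f :: "real \<Rightarrow> real"
  assumes X: "uniform01 \<Omega> X" and [measurable]: "f \<in> borel_measurable borel" and B: "\<And>u. \<bar>f u\<bar> \<le> B"
  shows "integrable \<Omega> (\<lambda>\<omega>. f (X \<omega>))"
proof -
  interpret prob_space \<Omega> using X by (rule uniform01_prob_space)
  have [measurable]: "X \<in> borel_measurable \<Omega>" using X by (simp add: uniform01_def)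
  show ?thesis by (rule integrable_const_bound[where B = B]) (auto simp: B)
qed

lemma uniform01_integrable_continuous:
  fixes g :: "real \<times> real \<Rightarrow> real"
  assumes U: "uniform01 \<Omega> U" and V: "uniform01 \<Omega> V" and g: "continuous_on UNIV g"
  shows "integrable \<Omega> (\<lambda>\<omega>. g (U \<omega>, V \<omega>))"
proof -
  interpret prob_space \<Omega> using U by (rule uniform01_prob_space)
  have [measurable]: "U \<in> borel_measurable \<Omega>" "V \<in> borel_measurable \<Omega>" "g \<in> borel_measurable borel"
    using U V g by (auto simp: uniform01_def intro: borel_measurable_continuous_onI)
  have "compact (g ` ({0..1} \<times> {0..1}))"
    by (intro compact_continuous_image compact_Times continuous_on_subset[OF g]) auto
  then obtain B where B: "\<And>x. x \<in> {0..1} \<times> {0..1} \<Longrightarrow> norm (g x) \<le> B"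
    by (meson bounded_iff compact_imp_bounded image_eqI)
  show ?thesis
  proof (rule integrable_const_bound)
    show "AE \<omega> in \<Omega>. norm (g (U \<omega>, V \<omega>)) \<le> B"
      using uniform01_AE[OF U] uniform01_AE[OF V] by eventually_elim (rule B, auto)
  qed measurable
qed

text \<open>Quadrants with corners in the unit square suffice.  The values at \<open>(1, 1)\<close>, \<open>(0, 1)\<close>
and \<open>(1, 0)\<close> already confine \<open>\<mu>\<close> to \<open>(0, 1] \<times> (0, 1]\<close>, so a corner anywhere in the plane may be
clamped to the square without changing either measure, and the closed quadrants are an
intersection-stable generator of the Borel sets.\<close>

lemma joint_law_unique:
  fixes \<mu> \<nu> :: "(real \<times> real) measure"
  assumes "prob_space \<mu>" and sets: "sets \<mu> = sets borel" "sets \<nu> = sets borel"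
    and unif: "uniform01 \<nu> fst" "uniform01 \<nu> snd"
    and eq: "\<And>u v. u \<in> {0..1} \<Longrightarrow> v \<in> {0..1} \<Longrightarrow>
      measure \<mu> ({..u} \<times> {..v}) = measure \<nu> ({..u} \<times> {..v})"
  shows "\<mu> = \<nu>"
proof -
  interpret \<mu>: prob_space \<mu> by fact
  interpret \<nu>: prob_space \<nu> using unif(1) by (rule uniform01_prob_space)
  note [measurable_cong] = sets
  have sp: "space \<mu> = UNIV" "space \<nu> = UNIV"
    using sets by (metis sets_eq_imp_space_eq space_borel)+
  have [measurable]: "{..u} \<times> {..v} \<in> sets borel" for u v :: real
    by (intro borel_closed closed_Times) auto
  have \<nu>AE: "AE z in \<nu>. fst z \<in> {0<..1} \<and> snd z \<in> {0<..1}"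
    using uniform01_AE[OF unif(1)] uniform01_AE[OF unif(2)] by eventually_elim auto
  have \<nu>1: "measure \<nu> ({..1} \<times> {..1}) = 1"
    by (subst \<nu>.prob_eq_1) (use \<nu>AE in \<open>auto simp: sets\<close>)
  have \<nu>0: "measure \<nu> ({..0} \<times> {..1}) = 0" "measure \<nu> ({..1} \<times> {..0}) = 0"
    by (subst \<nu>.prob_eq_0; use \<nu>AE in \<open>auto simp: sets\<close>)+
  have "measure \<mu> ({..1} \<times> {..1}) = 1" "measure \<mu> ({..0} \<times> {..1}) = 0" "measure \<mu> ({..1} \<times> {..0}) = 0"
    using eq[of 1 1] eq[of 0 1] eq[of 1 0] \<nu>1 \<nu>0 by auto
  then have "AE z in \<mu>. z \<in> {..1} \<times> {..1}" "AE z in \<mu>. z \<notin> {..0} \<times> {..1}" "AE z in \<mu>. z \<notin> {..1} \<times> {..0}"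
    using \<mu>.prob_eq_1[of "{..1} \<times> {..1}"] \<mu>.prob_eq_0[of "{..0} \<times> {..1}"] \<mu>.prob_eq_0[of "{..1} \<times> {..0}"]
    by (auto simp: sets)
  then have \<mu>AE: "AE z in \<mu>. fst z \<in> {0<..1} \<and> snd z \<in> {0<..1}"
    by eventually_elim (auto simp: not_le)
  define cl :: "real \<Rightarrow> real" where "cl u = max 0 (min 1 u)" for u
  have clamp: "measure M ({..u} \<times> {..v}) = measure M ({..cl u} \<times> {..cl v})"
    if "sets M = sets borel" "AE z in M. fst z \<in> {0<..1} \<and> snd z \<in> {0<..1}" for M u v
  proof (rule measure_eq_AE)
    show "AE z in M. z \<in> {..u} \<times> {..v} \<longleftrightarrow> z \<in> {..cl u} \<times> {..cl v}"
      using that(2) by eventually_elim (auto simp: cl_def)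
  qed (simp_all add: that(1))
  have all: "measure \<mu> ({..u} \<times> {..v}) = measure \<nu> ({..u} \<times> {..v})" for u v
    using clamp[OF sets(1) \<mu>AE, of u v] clamp[OF sets(2) \<nu>AE, of u v] eq[of "cl u" "cl v"]
    by (simp add: cl_def)
  have atMost: "{..z} = {..fst z} \<times> {..snd z}" for z :: "real \<times> real"
    by (auto simp: less_eq_prod_def)
  have gen: "sets borel = sigma_sets UNIV (range (\<lambda>z :: real \<times> real. {..z}))"
    unfolding borel_eq_atMost by (simp add: sets_measure_of)
  show ?thesis
  proof (rule measure_eqI_generator_eq[where E = "range (\<lambda>z :: real \<times> real. {..z})" and \<Omega> = UNIV
        and A = "\<lambda>n. {..(real n, real n)}"])
    show "Int_stable (range (\<lambda>z :: real \<times> real. {..z}))"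
    proof (rule Int_stableI)
      fix A B assume "A \<in> range (\<lambda>z :: real \<times> real. {..z})" "B \<in> range (\<lambda>z :: real \<times> real. {..z})"
      then obtain y z where AB: "A = {..y}" "B = {..z}" by auto
      have "A \<inter> B = {..(min (fst y) (fst z), min (snd y) (snd z))}"
        unfolding AB by (auto simp: less_eq_prod_def)
      then show "A \<inter> B \<in> range (\<lambda>z :: real \<times> real. {..z})" by blast
    qed
    show "emeasure \<mu> X = emeasure \<nu> X" if "X \<in> range (\<lambda>z :: real \<times> real. {..z})" for X
      using that all by (auto simp: \<mu>.emeasure_eq_measure \<nu>.emeasure_eq_measure atMost)
    show "(\<Union>n. {..(real n, real n)}) = UNIV"
    proof (intro set_eqI iffI UNIV_I)
      fix z :: "real \<times> real"
      obtain n where "max (fst z) (snd z) \<le> real n" using real_arch_simple by blast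
      then show "z \<in> (\<Union>n. {..(real n, real n)})" by (auto simp: less_eq_prod_def)
    qed
  qed (use sets gen in auto)
qed

lemma has_copula_joint_law:
  assumes C: "has_copula \<Omega> U V C"
    and \<mu>: "sets \<mu> = sets borel" "uniform01 \<mu> fst" "uniform01 \<mu> snd"
      "\<And>u v. u \<in> {0..1} \<Longrightarrow> v \<in> {0..1} \<Longrightarrow> C u v = measure \<mu> ({..u} \<times> {..v})"
  shows "distr \<Omega> borel (\<lambda>\<omega>. (U \<omega>, V \<omega>)) = \<mu>"
proof -
  interpret prob_space \<Omega> using C by (simp add: has_copula_def)
  have [measurable]: "U \<in> borel_measurable \<Omega>" "V \<in> borel_measurable \<Omega>"
    using C by (auto simp: has_copula_def)
  have [measurable]: "{..u} \<times> {..v} \<in> sets borel" for u v :: real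
    by (intro borel_closed closed_Times) auto
  show ?thesis
  proof (rule joint_law_unique)
    show "prob_space (distr \<Omega> borel (\<lambda>\<omega>. (U \<omega>, V \<omega>)))"
      by (rule prob_space_distr) measurable
    show "measure (distr \<Omega> borel (\<lambda>\<omega>. (U \<omega>, V \<omega>))) ({..u} \<times> {..v}) = measure \<mu> ({..u} \<times> {..v})"
      if "u \<in> {0..1}" "v \<in> {0..1}" for u v
    proof -
      have "measure (distr \<Omega> borel (\<lambda>\<omega>. (U \<omega>, V \<omega>))) ({..u} \<times> {..v})
          = measure \<Omega> {\<omega> \<in> space \<Omega>. U \<omega> \<le> u \<and> V \<omega> \<le> v}"
        by (subst measure_distr) (auto intro!: arg_cong[where f = "measure \<Omega>"])
      then show ?thesis
        using C \<mu>(4) that by (auto simp: has_copula_def)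
    qed
  qed (use \<mu> in auto)
qed

lemma has_copula_margins_and_integral:
  assumes C: "has_copula \<Omega> U V C"
    and \<mu>: "sets \<mu> = sets borel" "uniform01 \<mu> fst" "uniform01 \<mu> snd"
      "\<And>u v. u \<in> {0..1} \<Longrightarrow> v \<in> {0..1} \<Longrightarrow> C u v = measure \<mu> ({..u} \<times> {..v})"
  shows "uniform01 \<Omega> U" "uniform01 \<Omega> V"
    and "\<And>g :: real \<times> real \<Rightarrow> real. g \<in> borel_measurable borel \<Longrightarrow>
      (\<integral>\<omega>. g (U \<omega>, V \<omega>) \<partial>\<Omega>) = (\<integral>z. g z \<partial>\<mu>)"
proof -
  have [measurable]: "U \<in> borel_measurable \<Omega>" "V \<in> borel_measurable \<Omega>"
    using C by (auto simp: has_copula_def)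
  have law: "\<mu> = distr \<Omega> borel (\<lambda>\<omega>. (U \<omega>, V \<omega>))"
    using has_copula_joint_law[OF assms] by simp
  show "uniform01 \<Omega> U" "uniform01 \<Omega> V"
    using \<mu>(2,3) by (auto simp: uniform01_def law distr_distr comp_def)
  show "(\<integral>\<omega>. g (U \<omega>, V \<omega>) \<partial>\<Omega>) = (\<integral>z. g z \<partial>\<mu>)" if [measurable]: "g \<in> borel_measurable borel"
    for g :: "real \<times> real \<Rightarrow> real"
    unfolding law by (subst integral_distr) auto
qed

section \<open>The dual potential\<close>

text \<open>The distance from \<open>x\<close> to the lattice \<open>2 a \<int>\<close>.  It folds the line onto \<open>[0, a]\<close>, with the
multiples of \<open>2 a\<close> going to \<open>0\<close> and the points half-way between them to \<open>a\<close>.\<close>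

definition fold_wave :: "real \<Rightarrow> real \<Rightarrow> real" where
  "fold_wave a x = \<bar>x - 2 * a * of_int (round (x / (2 * a)))\<bar>"

lemma fold_wave_le_lattice:
  assumes "a > 0" shows "fold_wave a x \<le> \<bar>x - 2 * a * of_int k\<bar>"
proof -
  have *: "\<bar>x - 2 * a * of_int j\<bar> = 2 * a * \<bar>x / (2 * a) - of_int j\<bar>" for j
  proof -
    have "x - 2 * a * of_int j = 2 * a * (x / (2 * a) - of_int j)"
      using assms by (simp add: field_simps)
    then show ?thesis using assms by (simp add: abs_mult)
  qed
  show ?thesis
    unfolding fold_wave_def * using assms
    by (intro mult_left_mono round_diff_minimal) auto
qed

lemma fold_wave_nonneg: "fold_wave a x \<ge> 0"
  by (simp add: fold_wave_def)

lemma fold_wave_le: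
  assumes "a > 0" shows "fold_wave a x \<le> a"
proof -
  have "\<bar>x / (2 * a) - of_int (round (x / (2 * a)))\<bar> \<le> 1 / 2"
    using of_int_round_abs_le[of "x / (2 * a)"] by (simp add: abs_minus_commute)
  then have "2 * a * \<bar>x / (2 * a) - of_int (round (x / (2 * a)))\<bar> \<le> 2 * a * (1 / 2)"
    using assms by (intro mult_left_mono) auto
  moreover have "2 * a * \<bar>x / (2 * a) - of_int (round (x / (2 * a)))\<bar> = fold_wave a x"
    unfolding fold_wave_def using assms
    by (simp add: abs_mult_pos' right_diff_distrib)
  ultimately show ?thesis by simp
qed

lemma fold_wave_eq:
  assumes "a > 0" "\<bar>x - 2 * a * of_int k\<bar> \<le> a"
  shows "fold_wave a x = \<bar>x - 2 * a * of_int k\<bar>"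
proof (rule antisym[OF fold_wave_le_lattice[OF assms(1)]])
  define j where "j = round (x / (2 * a))"
  show "\<bar>x - 2 * a * of_int k\<bar> \<le> fold_wave a x"
  proof (cases "j = k")
    case False
    then have "1 \<le> \<bar>of_int (k - j) :: real\<bar>" by linarith
    then have "2 * a * 1 \<le> 2 * a * \<bar>of_int (k - j) :: real\<bar>"
      using assms by (intro mult_left_mono) auto
    also have "\<dots> = \<bar>2 * a * of_int k - 2 * a * of_int j\<bar>"
      using assms(1) by (simp add: abs_mult right_diff_distrib[symmetric])
    also have "\<dots> \<le> \<bar>x - 2 * a * of_int k\<bar> + fold_wave a x"
      unfolding fold_wave_def j_def by linarith
    finally show ?thesis using assms by linarith
  qed (simp add: fold_wave_def j_def)
qed

text \<open>Folding does not increase distances, so an inequality whose right-hand side is a squared distance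
need be proved on \<open>[0, a]\<close> only.\<close>

lemma fold_wave_lipschitz:
  assumes "a > 0" shows "\<bar>fold_wave a x - fold_wave a y\<bar> \<le> \<bar>x - y\<bar>"
proof -
  have "fold_wave a x \<le> fold_wave a y + \<bar>x - y\<bar>" for x y
    using fold_wave_le_lattice[OF assms, of x "round (y / (2 * a))"] unfolding fold_wave_def[of a y]
    by linarith
  from this[of x y] this[of y x] show ?thesis by linarith
qed

lemma fold_wave_half_period:
  assumes "a > 0" shows "fold_wave a (x + a) = a - fold_wave a x"
proof -
  define k where "k = round (x / (2 * a))"
  define r where "r = x - 2 * a * of_int k"
  have r: "fold_wave a x = \<bar>r\<bar>" "\<bar>r\<bar> \<le> a"
    using fold_wave_le[OF assms, of x] by (simp_all add: fold_wave_def r_def k_def)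
  show ?thesis
  proof (cases "r \<le> 0")
    case True
    then have "fold_wave a (x + a) = \<bar>x + a - 2 * a * of_int k\<bar>"
      using r assms by (intro fold_wave_eq) (auto simp: r_def)
    with True r show ?thesis by (simp add: r_def)
  next
    case False
    then have "fold_wave a (x + a) = \<bar>x + a - 2 * a * of_int (k + 1)\<bar>"
      using r assms by (intro fold_wave_eq) (auto simp: r_def algebra_simps)
    with False r show ?thesis by (simp add: r_def algebra_simps)
  qed
qed

lemma fold_wave_measurable [measurable]: "fold_wave a \<in> borel_measurable borel"
  unfolding fold_wave_def[abs_def] round_def by measurable

text \<open>Tightness on the pair formed by the top of a cap and the bottom of the next cup forces the latter to lie
at minus the height of the former.  The value of the height is the one for which a line of slope
\<open>-v\<close> joins the two parabolas smoothly.\<close>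

definition cap_height :: "real \<Rightarrow> real \<Rightarrow> real \<Rightarrow> real" where
  "cap_height n v a = (v * a - (2 * n + 1) * v\<^sup>2 / 4) / 2"

text \<open>Half a period of the dual potential, from the top of a cap at \<open>0\<close> to the bottom of a cup at \<open>a\<close>.
Tightness dictates the shape: on a pair at distance \<open>g\<close>, the derivative of the potential at the
two points is \<open>-2 (g - a)\<close> and \<open>2 (g - a)\<close>.  As \<open>g\<close> sweeps the interval \<open>[a - v/2, a + v/2]\<close>
the derivative sweeps \<open>[-v, v]\<close>, over an interval of length \<open>n v\<close> at the lower end of the pair and of
length \<open>(n + 1) v\<close> at the upper end.  This gives a downward parabola of curvature \<open>-2/n\<close> and an
upward one of curvature \<open>2/(n + 1)\<close>; pairs at the constant distance \<open>a \<plusminus> v/2\<close> give the line of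
slope \<open>-v\<close> between them.\<close>

definition half_potential :: "real \<Rightarrow> real \<Rightarrow> real \<Rightarrow> real \<Rightarrow> real" where
  "half_potential n v a y =
     (if y \<le> n * v / 2 then cap_height n v a - y\<^sup>2 / n
      else if a - y \<le> (n + 1) * v / 2 then (a - y)\<^sup>2 / (n + 1) - cap_height n v a
      else cap_height n v a + n * v\<^sup>2 / 4 - v * y)"

lemma half_potential_measurable [measurable]: "half_potential n v a \<in> borel_measurable borel"
  unfolding half_potential_def[abs_def] by measurable

lemma parabola_above_tangent:
  fixes c :: real assumes "c > 0" shows "v * y - c * v\<^sup>2 / 4 \<le> y\<^sup>2 / c"
proof -
  have "0 \<le> (y - c * v / 2)\<^sup>2 / c" using assms by simp
  also have "\<dots> = y\<^sup>2 / c - (v * y - c * v\<^sup>2 / 4)"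
    using assms by (simp add: field_simps power2_eq_square)
  finally show ?thesis by simp
qed

lemma vertex_value:
  fixes c :: real assumes "c > 0" shows "(c * v / 2)\<^sup>2 / c = c * v\<^sup>2 / 4"
  using assms by (simp add: power2_eq_square field_simps)

text \<open>The parabola \<open>w\<^sup>2 / (n + 1)\<close> is the infimal convolution of \<open>y\<^sup>2 / n\<close> and \<open>y\<^sup>2\<close>, attained where
\<open>(n + 1) y = n w\<close>.  This is why caps of parameter \<open>n\<close> are matched with cups of parameter \<open>n + 1\<close>.\<close>

lemma parabola_inf_convolution:
  fixes n :: real assumes "n > 0" shows "w\<^sup>2 / (n + 1) \<le> y\<^sup>2 / n + (w - y)\<^sup>2"
proof -
  have "0 \<le> ((n + 1) * y - n * w)\<^sup>2 / (n * (n + 1))" using assms by simp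
  also have "\<dots> = y\<^sup>2 / n + (w - y)\<^sup>2 - w\<^sup>2 / (n + 1)"
    using assms by (simp add: divide_simps) (simp add: algebra_simps power2_eq_square)
  finally show ?thesis by simp
qed

context
  fixes n v a :: real
  assumes n: "n > 0" and v: "v \<ge> 0" and a: "(2 * n + 1) * v / 2 \<le> a"
begin

text \<open>The cup parabola dominates the line because it is tangent to it, and dominates the cap because the
line separates the two parabolas.\<close>

lemma half_potential_le_cup:
  "half_potential n v a y \<le> (a - y)\<^sup>2 / (n + 1) - cap_height n v a"
  using parabola_above_tangent[OF n, of v y] parabola_above_tangent[of "n + 1" v "a - y"] n
  unfolding half_potential_def cap_height_def
  by (auto simp: algebra_simps add_divide_distrib diff_divide_distrib)

lemma half_potential_add_le_of_cap:
  assumes "y \<le> n * v / 2"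
  shows "half_potential n v a y + half_potential n v a z \<le> (a - y - z)\<^sup>2"
proof -
  have "half_potential n v a y = cap_height n v a - y\<^sup>2 / n"
    using assms by (simp add: half_potential_def)
  then show ?thesis
    using half_potential_le_cup[of z] parabola_inf_convolution[OF n, of "a - z" y]
    by (simp add: algebra_simps)
qed

text \<open>At the foot \<open>y = n v / 2\<close> of the cap the claim is an instance of the infimal convolution.  Moving \<open>y\<close>
by \<open>r\<close> along the line lowers the left-hand side by \<open>v r\<close>.  The right-hand side is convex in \<open>y\<close> and falls
at the foot at a rate of at most \<open>v\<close>, because \<open>a - z \<le> (n + 1) v / 2\<close>.\<close>

lemma half_potential_add_le_of_cup:
  assumes y: "n * v / 2 \<le> y" and z: "a - z \<le> (n + 1) * v / 2" "n * v / 2 < z"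
    and Fy: "half_potential n v a y = cap_height n v a + n * v\<^sup>2 / 4 - v * y"
  shows "half_potential n v a y + half_potential n v a z \<le> (a - y - z)\<^sup>2"
proof -
  define r where "r = y - n * v / 2"
  define w where "w = a - z"
  have Fz: "half_potential n v a z = w\<^sup>2 / (n + 1) - cap_height n v a"
    using z by (simp add: half_potential_def w_def)
  have "0 \<le> r" "2 * w \<le> (n + 1) * v"
    using y z by (simp_all add: r_def w_def)
  then have "0 \<le> r * ((n + 1) * v - 2 * w) + r\<^sup>2"
    by simp
  moreover have "w\<^sup>2 / (n + 1) \<le> n * v\<^sup>2 / 4 + (w - n * v / 2)\<^sup>2"
    using parabola_inf_convolution[OF n, of w "n * v / 2"] vertex_value[OF n, of v] by simp
  moreover have "(a - y - z)\<^sup>2 = (w - n * v / 2)\<^sup>2 - 2 * r * (w - n * v / 2) + r\<^sup>2"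
    unfolding r_def w_def by (simp add: power2_eq_square algebra_simps)
  moreover have "v * y = n * v\<^sup>2 / 2 + v * r"
    unfolding r_def by (simp add: power2_eq_square algebra_simps)
  moreover have "r * ((n + 1) * v - 2 * w) = v * r - 2 * r * (w - n * v / 2)"
    by (simp add: algebra_simps)
  ultimately show ?thesis
    unfolding Fy Fz by linarith
qed

text \<open>In the distances \<open>i\<close> and \<open>j\<close> from the rims of the cups, the difference of the two sides is
\<open>(D + v/2)\<^sup>2 + (2 D + v) (i + j) + (i + j)\<^sup>2 - (i\<^sup>2 + j\<^sup>2) / (n + 1)\<close> with \<open>D = a - (n + 1) v\<close>, and the
hypothesis on \<open>a\<close> says exactly that \<open>2 D + v \<ge> 0\<close>.\<close>

lemma half_potential_add_le_of_cups:
  assumes y: "a - y \<le> (n + 1) * v / 2" "n * v / 2 < y" and z: "a - z \<le> (n + 1) * v / 2" "n * v / 2 < z"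
  shows "half_potential n v a y + half_potential n v a z \<le> (a - y - z)\<^sup>2"
proof -
  define i where "i = (n + 1) * v / 2 - (a - y)"
  define j where "j = (n + 1) * v / 2 - (a - z)"
  define D where "D = a - (n + 1) * v"
  have ij: "i \<ge> 0" "j \<ge> 0" and D: "2 * D + v \<ge> 0"
    using y z a by (simp_all add: i_def j_def D_def field_simps)
  have yz: "a - y = (n + 1) * v / 2 - i" "a - z = (n + 1) * v / 2 - j" and aD: "a = D + (n + 1) * v"
    by (simp_all add: i_def j_def D_def)
  have eq: "a - y - z = - (D + (i + j))"
    using yz aD by (simp add: field_simps)
  have sq: "((n + 1) * v / 2 - t)\<^sup>2 / (n + 1) = (n + 1) * v\<^sup>2 / 4 - v * t + t\<^sup>2 / (n + 1)" for t
    using n by (simp add: divide_simps) (simp add: power2_eq_square algebra_simps)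
  have Fs: "half_potential n v a y + half_potential n v a z
      = (n + 1) * v\<^sup>2 / 2 - v * (i + j) + (i\<^sup>2 + j\<^sup>2) / (n + 1) - v * a + (2 * n + 1) * v\<^sup>2 / 4"
    using y z by (simp add: half_potential_def yz sq cap_height_def)
      (simp add: field_simps add_divide_distrib)
  have "(i\<^sup>2 + j\<^sup>2) / (n + 1) \<le> (i\<^sup>2 + j\<^sup>2) / 1"
    using n by (intro divide_left_mono) auto
  also have "\<dots> \<le> (i + j)\<^sup>2"
    using ij by (simp add: power2_sum)
  finally have "(i\<^sup>2 + j\<^sup>2) / (n + 1) \<le> (i + j)\<^sup>2" .
  moreover have "0 \<le> (D + v / 2)\<^sup>2 + (2 * D + v) * (i + j)"
    using ij D by simp
  ultimately show ?thesis
    unfolding Fs eq by (subst aD) (simp add: power2_eq_square algebra_simps add_divide_distrib)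
qed

text \<open>Feasibility of the potential on the folded line.  The claim is symmetric in \<open>y\<close> and \<open>z\<close>, which
leaves one case for a cap, the mixed case, the case of two cups, and the case of two
lines, where the difference of the sides is \<open>(a - y - z - v/2)\<^sup>2\<close>.\<close>

lemma half_potential_add_le:
  "half_potential n v a y + half_potential n v a z \<le> (a - y - z)\<^sup>2"
proof -
  have comm: "(a - z - y)\<^sup>2 = (a - y - z)\<^sup>2" by (simp add: algebra_simps)
  consider "y \<le> n * v / 2" | "z \<le> n * v / 2"
    | "n * v / 2 < y" "a - y \<le> (n + 1) * v / 2" "n * v / 2 < z" "a - z \<le> (n + 1) * v / 2"
    | "n * v / 2 < y" "\<not> a - y \<le> (n + 1) * v / 2" "n * v / 2 < z" "a - z \<le> (n + 1) * v / 2"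
    | "n * v / 2 < y" "a - y \<le> (n + 1) * v / 2" "n * v / 2 < z" "\<not> a - z \<le> (n + 1) * v / 2"
    | "n * v / 2 < y" "\<not> a - y \<le> (n + 1) * v / 2" "n * v / 2 < z" "\<not> a - z \<le> (n + 1) * v / 2"
    by linarith
  then show ?thesis
  proof cases
    case 1 then show ?thesis by (rule half_potential_add_le_of_cap)
  next
    case 2 then show ?thesis
      using half_potential_add_le_of_cap[of z y] comm by simp
  next
    case 3 then show ?thesis by (intro half_potential_add_le_of_cups)
  next
    case 4 then show ?thesis
      by (intro half_potential_add_le_of_cup) (auto simp: half_potential_def)
  next
    case 5
    then have "half_potential n v a z + half_potential n v a y \<le> (a - z - y)\<^sup>2"
      by (intro half_potential_add_le_of_cup) (auto simp: half_potential_def)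
    then show ?thesis using comm by simp
  next
    case 6
    have "0 \<le> (a - y - z - v / 2)\<^sup>2" by simp
    then show ?thesis
      using 6 by (simp add: half_potential_def cap_height_def power2_eq_square field_simps)
  qed
qed

text \<open>The branches of the definition overlap when the line has length zero; then they agree, by the
choice of the height of the cap.\<close>

lemma half_potential_cup:
  assumes y: "a - y \<le> (n + 1) * v / 2"
  shows "half_potential n v a y = (a - y)\<^sup>2 / (n + 1) - cap_height n v a"
proof (cases "y \<le> n * v / 2")
  case True
  then have y': "y = n * v / 2" "a - y = (n + 1) * v / 2"
    using y a by (simp_all add: field_simps)
  then have a': "a = (2 * n + 1) * v / 2" by (simp add: field_simps)
  have "half_potential n v a y = cap_height n v a - y\<^sup>2 / n"
    using True by (simp add: half_potential_def)
  moreover have "y\<^sup>2 / n = n * v\<^sup>2 / 4"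
    unfolding y'(1) by (rule vertex_value[OF n])
  moreover have "(a - y)\<^sup>2 / (n + 1) = (n + 1) * v\<^sup>2 / 4"
    unfolding y'(2) using vertex_value[of "n + 1" v] n by simp
  moreover have "cap_height n v a = (2 * n + 1) * v\<^sup>2 / 8"
    unfolding cap_height_def a' by (simp add: power2_eq_square algebra_simps)
  ultimately show ?thesis by (simp add: field_simps)
qed (use y in \<open>simp add: half_potential_def\<close>)

lemma half_potential_mid:
  assumes y: "n * v / 2 \<le> y" "(n + 1) * v / 2 \<le> a - y"
  shows "half_potential n v a y = cap_height n v a + n * v\<^sup>2 / 4 - v * y"
proof -
  consider "y = n * v / 2" | "a - y = (n + 1) * v / 2" | "n * v / 2 < y" "(n + 1) * v / 2 < a - y"
    using y by linarith
  then show ?thesis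
  proof cases
    case 1
    have "y\<^sup>2 / n = n * v\<^sup>2 / 4"
      unfolding 1 by (rule vertex_value[OF n])
    moreover have "v * y = n * v\<^sup>2 / 2"
      unfolding 1 by (simp add: power2_eq_square)
    moreover have "half_potential n v a y = cap_height n v a - y\<^sup>2 / n"
      using 1 by (simp add: half_potential_def)
    ultimately show ?thesis by linarith
  next
    case 2
    then have y': "y = a - (n + 1) * v / 2" by simp
    have "half_potential n v a y = (n + 1) * v\<^sup>2 / 4 - cap_height n v a"
      using half_potential_cup[of y] 2 vertex_value[of "n + 1" v] n by simp
    then show ?thesis
      unfolding y' by (simp add: cap_height_def power2_eq_square algebra_simps add_divide_distrib diff_divide_distrib)
  qed (simp add: half_potential_def)
qed

end

text \<open>Unfolding gives a function of period \<open>2 a\<close> whose caps are centred at \<open>c + 2 a \<int>\<close>.\<close>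

definition dual_potential :: "real \<Rightarrow> real \<Rightarrow> real \<Rightarrow> real \<Rightarrow> real \<Rightarrow> real" where
  "dual_potential n v a c u = half_potential n v a (fold_wave a (u - c))"

lemma dual_potential_measurable [measurable]: "dual_potential n v a c \<in> borel_measurable borel"
  unfolding dual_potential_def[abs_def] by measurable

lemma dual_potential_bounded:
  assumes "n > 0" "v \<ge> 0" "a > 0"
  shows "\<exists>B. \<forall>u. \<bar>dual_potential n v a c u\<bar> \<le> B"
proof -
  let ?K = "\<bar>cap_height n v a\<bar>"
  have "\<bar>half_potential n v a y\<bar> \<le> ?K + a\<^sup>2 / n + a\<^sup>2 / (n + 1) + n * v\<^sup>2 / 4 + v * a" if y: "0 \<le> y" "y \<le> a" for y
  proof -
    have "y\<^sup>2 / n \<le> a\<^sup>2 / n" "(a - y)\<^sup>2 / (n + 1) \<le> a\<^sup>2 / (n + 1)" "v * y \<le> v * a"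
      using assms y by (auto intro!: divide_right_mono power_mono mult_left_mono)
    moreover have "0 \<le> y\<^sup>2 / n" "0 \<le> (a - y)\<^sup>2 / (n + 1)" "0 \<le> v * y" "0 \<le> n * v\<^sup>2 / 4"
      using assms y by auto
    ultimately show ?thesis
      unfolding half_potential_def by (auto simp: abs_le_iff)
  qed
  then show ?thesis
    unfolding dual_potential_def using fold_wave_nonneg fold_wave_le[OF assms(3)] by blast
qed

context
  fixes n v a c :: real
  assumes n: "n > 0" and v: "v \<ge> 0" and a: "a > 0" "(2 * n + 1) * v / 2 \<le> a"
begin

text \<open>For \<open>x \<le> y\<close> the folded image of \<open>y\<close> is \<open>a\<close> minus that of \<open>y - a\<close>.  So the bound on the folded line
is a squared difference of the images of \<open>x\<close> and \<open>y - a\<close>, and these two points are \<open>\<bar>y - x - a\<bar>\<close> apart.\<close>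

lemma dual_potential_feasible:
  "dual_potential n v a c x + dual_potential n v a c y \<le> (\<bar>x - y\<bar> - a)\<^sup>2"
proof -
  have *: "dual_potential n v a c x + dual_potential n v a c y \<le> (\<bar>x - y\<bar> - a)\<^sup>2" if "x \<le> y" for x y
  proof -
    define w where "w = fold_wave a (y - c - a)"
    have w: "fold_wave a (y - c) = a - w"
      using fold_wave_half_period[OF a(1), of "y - c - a"] by (simp add: w_def)
    have "dual_potential n v a c x + dual_potential n v a c y \<le> (a - fold_wave a (x - c) - fold_wave a (y - c))\<^sup>2"
      unfolding dual_potential_def by (rule half_potential_add_le[OF n v a(2)])
    also have "\<dots> = \<bar>w - fold_wave a (x - c)\<bar>\<^sup>2"
      by (simp add: w)
    also have "\<dots> \<le> \<bar>(y - c - a) - (x - c)\<bar>\<^sup>2"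
      unfolding w_def by (intro power_mono fold_wave_lipschitz[OF a(1)]) simp
    also have "\<dots> = (\<bar>x - y\<bar> - a)\<^sup>2"
      using that by (simp add: algebra_simps)
    finally show ?thesis .
  qed
  show ?thesis
    using *[of x y] *[of y x] by (cases "x \<le> y") (auto simp: abs_minus_commute)
qed

lemma dual_potential_even_node:
  assumes "\<bar>r\<bar> \<le> a"
  shows "dual_potential n v a c (c + 2 * a * of_int k + r) = half_potential n v a \<bar>r\<bar>"
proof -
  have "fold_wave a (2 * a * of_int k + r) = \<bar>2 * a * of_int k + r - 2 * a * of_int k\<bar>"
    using assms a(1) by (intro fold_wave_eq) auto
  then show ?thesis
    unfolding dual_potential_def by (simp add: add.assoc)
qed

lemma dual_potential_odd_node:
  assumes "\<bar>r\<bar> \<le> a"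
  shows "dual_potential n v a c (c + 2 * a * of_int k + a + r) = half_potential n v a (a - \<bar>r\<bar>)"
proof -
  have "fold_wave a (2 * a * of_int k + r) = \<bar>2 * a * of_int k + r - 2 * a * of_int k\<bar>"
    using assms a(1) by (intro fold_wave_eq) auto
  then have "fold_wave a (2 * a * of_int k + r + a) = a - \<bar>r\<bar>"
    using fold_wave_half_period[OF a(1), of "2 * a * of_int k + r"] by simp
  then show ?thesis
    unfolding dual_potential_def by (simp add: add_ac)
qed

text \<open>Equality on pairs that join a cap to a cup at a varying distance: \<open>r\<close> and \<open>r + r / n\<close> are a minimiser
and its argument in the infimal convolution.\<close>

lemma dual_potential_tight_sloped:
  assumes "\<bar>r\<bar> \<le> n * v / 2"
  shows "dual_potential n v a c (c + 2 * a * of_int j + r)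
    + dual_potential n v a c (c + 2 * a * of_int k + a + (r + r / n)) = (r / n)\<^sup>2"
proof -
  have r': "\<bar>r + r / n\<bar> = (n + 1) * \<bar>r\<bar> / n"
  proof -
    have "r + r / n = (n + 1) * r / n" using n by (simp add: field_simps)
    then show ?thesis using n by (simp add: abs_mult)
  qed
  have le: "(n + 1) * \<bar>r\<bar> / n \<le> (n + 1) * v / 2"
  proof -
    have "\<bar>r\<bar> / n \<le> v / 2" using assms n by (simp add: field_simps)
    from mult_left_mono[OF this, of "n + 1"] n show ?thesis by simp
  qed
  have le': "(n + 1) * v / 2 \<le> (2 * n + 1) * v / 2" "n * v / 2 \<le> (2 * n + 1) * v / 2"
    using n v by (auto intro!: mult_right_mono divide_right_mono)
  have "dual_potential n v a c (c + 2 * a * of_int j + r) = cap_height n v a - r\<^sup>2 / n"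
    using assms a le' by (subst dual_potential_even_node) (auto simp: half_potential_def)
  moreover have "dual_potential n v a c (c + 2 * a * of_int k + a + (r + r / n))
      = ((n + 1) * \<bar>r\<bar> / n)\<^sup>2 / (n + 1) - cap_height n v a"
  proof (subst dual_potential_odd_node)
    show "\<bar>r + r / n\<bar> \<le> a" unfolding r' using le le'(1) a(2) by linarith
  qed (use le in \<open>simp add: r' half_potential_cup[OF n v a(2)]\<close>)
  moreover have "((n + 1) * \<bar>r\<bar> / n)\<^sup>2 / (n + 1) - r\<^sup>2 / n = (r / n)\<^sup>2"
    using n by (simp add: power_mult_distrib power_divide divide_simps) (simp add: algebra_simps power2_eq_square)
  ultimately show ?thesis by simp
qed

text \<open>Equality on pairs that join two lines at the constant distance \<open>a + \<sigma> v / 2\<close>.\<close>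

lemma dual_potential_tight_straight:
  assumes s: "0 \<le> s" "s \<le> a - (2 * n + 1) * v / 2" and \<sigma>: "\<bar>\<sigma>\<bar> = 1"
  shows "dual_potential n v a c (c + 2 * a * of_int k + \<sigma> * (n * v / 2 + s))
    + dual_potential n v a c (c + 2 * a * of_int k + a + \<sigma> * ((n + 1) * v / 2 + s)) = (v / 2)\<^sup>2"
proof -
  have ab: "\<bar>\<sigma> * (n * v / 2 + s)\<bar> = n * v / 2 + s" "\<bar>\<sigma> * ((n + 1) * v / 2 + s)\<bar> = (n + 1) * v / 2 + s"
    using \<sigma> n v s(1) by (simp_all add: abs_mult)
  have nv: "0 \<le> n * v" using n v by simp
  have le: "n * v / 2 + s \<le> a" "(n + 1) * v / 2 + s \<le> a"
      "(n + 1) * v / 2 \<le> a - (n * v / 2 + s)" "n * v / 2 \<le> a - ((n + 1) * v / 2 + s)"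
    using s nv v by (simp_all add: algebra_simps add_divide_distrib)
  have "dual_potential n v a c (c + 2 * a * of_int k + \<sigma> * (n * v / 2 + s))
      = cap_height n v a + n * v\<^sup>2 / 4 - v * (n * v / 2 + s)"
    using le(1,3) s(1) by (subst dual_potential_even_node)
      (simp_all add: ab half_potential_mid[OF n v a(2)])
  moreover have "dual_potential n v a c (c + 2 * a * of_int k + a + \<sigma> * ((n + 1) * v / 2 + s))
      = cap_height n v a + n * v\<^sup>2 / 4 - v * (a - ((n + 1) * v / 2 + s))"
    using le(2,4) s(1) by (subst dual_potential_odd_node)
      (simp_all add: ab half_potential_mid[OF n v a(2)])
  ultimately show ?thesis
    by (simp add: cap_height_def power2_eq_square field_simps)
qed

end

section \<open>Ladder couplings\<close>

lemma coordinates_borel_measurable [measurable]: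
  "(fst :: real \<times> real \<Rightarrow> real) \<in> borel_measurable borel"
  "(snd :: real \<times> real \<Rightarrow> real) \<in> borel_measurable borel"
  by (intro borel_measurable_continuous_onI continuous_intros)+

text \<open>The constructions of \<open>\<nu>\<^sub>x\<close> on the two halves of \<open>I\<^sub>N\<close> are one picture.  The unit interval is cut into blocks
\<open>2 a k + [b, b + N v]\<close> at which the caps of the dual potential sit, blocks of length \<open>(N + 1) v\<close> under its
cups, and blocks of length \<open>h\<close> in between, where it is linear.  Straight rungs join two blocks of length
\<open>h\<close> at the constant distance \<open>\<delta>\<close>.  A rising rung joins a cap block to the next cup block on its right and a
falling rung joins that cup block to the next cap block; their distances sweep \<open>[a - v/2, a + v/2]\<close> in
opposite directions.  Cutting the interval so that it starts and ends with a cap block gives the case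
of \<open>I\<^sub>N\<^sup>L\<close>; letting a block of length \<open>h\<close> overhang at either end, on the way up to the cap
and on the way down from it, gives that of \<open>I\<^sub>N\<^sup>R\<close>.\<close>

locale ladder =
  fixes N M :: nat and a v h e b \<delta> :: real
  assumes N: "N \<ge> 1" and v: "v \<ge> 0" and h: "h \<ge> 0"
    and a_eq: "a = h + (2 * real N + 1) * v / 2"
    and total: "2 * real M * h + 2 * real N * (real N + 1) * v = 1"
    and layout: "(M = N \<and> e = real N * v \<and> b = 0 \<and> \<delta> = a + v / 2) \<or>
                 (M = N + 1 \<and> e = 0 \<and> b = h \<and> \<delta> = a - v / 2)"
begin

definition straight :: "nat \<Rightarrow> real \<Rightarrow> real \<times> real" where
  "straight k s = (real k * (2 * a) + e + s, real k * (2 * a) + e + s + \<delta>)"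

definition rising :: "nat \<Rightarrow> real \<Rightarrow> real \<times> real" where
  "rising k t = (real k * (2 * a) + b + t, real k * (2 * a) + b + t + (a - v / 2 + t / real N))"

definition falling :: "nat \<Rightarrow> real \<Rightarrow> real \<times> real" where
  "falling k t = (real k * (2 * a) + b + t + (a - v / 2 + t / real N), (real k + 1) * (2 * a) + b + t)"

definition half_coupling :: "(real \<times> real) measure" where
  "half_coupling = add_measure
     (add_measure
       (sum_measure (\<lambda>k. push_leb (straight k) h) {0..<M})
       (sum_measure (\<lambda>k. scale_measure (ennreal (1 - real k / real N)) (push_leb (rising k) (real N * v))) {0..<N}))
     (sum_measure (\<lambda>k. scale_measure (ennreal ((real k + 1) / real N)) (push_leb (falling k) (real N * v))) {0..<N})"

definition coupling :: "(real \<times> real) measure" where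
  "coupling = add_measure half_coupling (distr half_coupling borel prod.swap)"

lemma sets_half_coupling [simp, measurable_cong]: "sets half_coupling = sets borel"
  by (simp add: half_coupling_def)

lemma sets_coupling [simp, measurable_cong]: "sets coupling = sets borel"
  by (simp add: coupling_def)

lemma rungs_measurable [measurable]:
  "straight k \<in> borel_measurable borel" "rising k \<in> borel_measurable borel" "falling k \<in> borel_measurable borel"
  unfolding straight_def[abs_def] rising_def[abs_def] falling_def[abs_def]
  using N by (intro borel_measurable_continuous_onI continuous_intros; simp)+

lemma swap_measurable [measurable]: "(prod.swap :: real \<times> real \<Rightarrow> real \<times> real) \<in> borel_measurable borel"
  by (intro borel_measurable_continuous_onI continuous_intros)

lemma nn_integral_half_coupling:
  assumes g: "g \<in> borel_measurable borel"
  shows "(\<integral>\<^sup>+z. g z \<partial>half_coupling) =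
    (\<Sum>k<M. \<integral>\<^sup>+s\<in>{0..h}. g (straight k s) \<partial>lborel)
    + (\<Sum>k<N. ennreal (1 - real k / real N) * (\<integral>\<^sup>+t\<in>{0..real N * v}. g (rising k t) \<partial>lborel))
    + (\<Sum>k<N. ennreal ((real k + 1) / real N) * (\<integral>\<^sup>+t\<in>{0..real N * v}. g (falling k t) \<partial>lborel))"
proof -
  have g': "g \<in> borel_measurable (push_leb F c)" for F c
    using g by (rule borel_measurable_of_sets_eq) simp
  show ?thesis
    unfolding half_coupling_def using g
    by (simp add: nn_integral_add_measure nn_integral_sum_measure nn_integral_scale_measure[OF g']
        nn_integral_push_leb rungs_measurable atLeast0LessThan)
qed

lemma nn_integral_coupling:
  assumes g [measurable]: "g \<in> borel_measurable borel"
  shows "(\<integral>\<^sup>+z. g z \<partial>coupling) = (\<integral>\<^sup>+z. g z + g (prod.swap z) \<partial>half_coupling)"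
  unfolding coupling_def
  by (subst nn_integral_add_measure) (auto simp: nn_integral_distr nn_integral_add)

lemma nn_integral_coupling_symmetric:
  assumes g [measurable]: "g \<in> borel_measurable borel" and sym: "\<And>x y. g (y, x) = g (x, y)"
  shows "(\<integral>\<^sup>+z. g z \<partial>coupling) = 2 * (\<integral>\<^sup>+z. g z \<partial>half_coupling)"
proof -
  have "g (prod.swap z) = g z" for z
    using sym by (cases z) simp
  then show ?thesis
    by (simp add: nn_integral_coupling nn_integral_add mult_2)
qed

text \<open>On a cup block the rising and the falling rung together have the weight \<open>(N + 1) / N\<close>, which offsets the
stretching of that block by the factor \<open>(N + 1) / N\<close>.  On the \<open>k\<close>-th cap block the rising rung that
leaves it has the weight \<open>1 - k / N\<close> and the falling rung that arrives has the weight \<open>k / N\<close>.  So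
every block carries Lebesgue measure, and the blocks tile the unit interval.\<close>

lemma half_coupling_margins:
  assumes g [measurable]: "g \<in> borel_measurable borel"
  shows "(\<integral>\<^sup>+z. g (fst z) + g (snd z) \<partial>half_coupling) = (\<integral>\<^sup>+t\<in>{0..1}. g t \<partial>lborel)"
proof -
  define J where "J x y = (\<integral>\<^sup>+t\<in>{x..y}. g t \<partial>lborel)" for x y
  define X where "X k = real k * (2 * a)" for k
  define Q where "Q k = (\<integral>\<^sup>+t\<in>{0..real N * v}. g (X k + b + t + (a - v / 2 + t / real N)) \<partial>lborel)" for k
  define JE where "JE k = J (X k + b) (X k + b + real N * v)" for k
  define JO where "JO k = J (X k + b + (a - v / 2)) (X k + b + (a - v / 2) + (real N + 1) * v)" for k
  define ST where "ST k = J (X k + e) (X k + e + h) + J (X k + e + \<delta>) (X k + e + \<delta> + h)" for k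
  have Npos: "real N > 0" using N by simp
  have XS: "X (Suc k) = X k + 2 * a" for k by (simp add: X_def algebra_simps)
  have shift: "(\<integral>\<^sup>+t\<in>{0..l}. g (x + t) \<partial>lborel) = J x (x + l)" for x l
    using set_nn_integral_affine[OF g, of 1 x l] by (simp add: J_def)
  have shift': "(\<integral>\<^sup>+t\<in>{0..l}. g (x + t + y) \<partial>lborel) = J (x + y) (x + y + l)" for x y l
    using shift[of "x + y" l] by (simp add: add_ac)
  have QJ: "ennreal ((real N + 1) / real N) * Q k = JO k" for k
  proof -
    have "Q k = (\<integral>\<^sup>+t\<in>{0..real N * v}. g (X k + b + (a - v / 2) + (real N + 1) / real N * t) \<partial>lborel)"
    proof -
      have "X k + b + t + (a - v / 2 + t / real N) = X k + b + (a - v / 2) + (real N + 1) / real N * t" for t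
        using Npos by (simp add: add_divide_distrib distrib_right)
      then show ?thesis unfolding Q_def by (simp only:)
    qed
    then show ?thesis
      using set_nn_integral_affine[OF g, of "(real N + 1) / real N" "X k + b + (a - v / 2)" "real N * v"] Npos
      by (simp add: JO_def J_def)
  qed
  have S: "(\<integral>\<^sup>+s\<in>{0..h}. g (fst (straight k s)) + g (snd (straight k s)) \<partial>lborel)
= ST k" for k
    by (simp add: ST_def straight_def X_def[symmetric] distrib_right nn_integral_add shift shift')
  have R: "(\<integral>\<^sup>+t\<in>{0..real N * v}. g (fst (rising k t)) + g (snd (rising k t)) \<partial>lborel) = JE k + Q k" for k
    by (simp add: rising_def X_def[symmetric] distrib_right nn_integral_add shift JE_def Q_def)
  have X1: "(real k + 1) * (2 * a) = X (Suc k)" for k by (simp add: X_def algebra_simps)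
  have F: "(\<integral>\<^sup>+t\<in>{0..real N * v}. g (fst (falling k t)) + g (snd (falling k t)) \<partial>lborel) = Q k + JE (Suc k)" for k
    unfolding falling_def fst_conv snd_conv X1
    by (simp add: X_def[symmetric] distrib_right nn_integral_add shift JE_def Q_def)
  have coefs: "ennreal (1 - real k / real N) + ennreal ((real k + 1) / real N) = ennreal ((real N + 1) / real N)"
    if "k < N" for k
    using that Npos by (subst ennreal_plus[symmetric]) (auto simp: field_simps)
  \<comment> \<open>The weight of the rising rung at \<open>k = N\<close> and of the falling rung at \<open>k = 0\<close> would be zero, so both
     sums may run over all \<open>N + 1\<close> cap blocks.\<close>
  have even: "(\<Sum>k<N. ennreal (1 - real k / real N) * JE k) + (\<Sum>k<N. ennreal ((real k + 1) / real N) * JE (Suc k))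
      = (\<Sum>k<Suc N. JE k)"
  proof -
    have "(\<Sum>k<N. ennreal (1 - real k / real N) * JE k) = (\<Sum>k<Suc N. ennreal (1 - real k / real N) * JE k)"
      using Npos by simp
    moreover have "(\<Sum>k<N. ennreal ((real k + 1) / real N) * JE (Suc k)) = (\<Sum>k<Suc N. ennreal (real k / real N) * JE k)"
      unfolding sum.lessThan_Suc_shift by (simp add: add.commute)
    moreover have "ennreal (1 - real k / real N) * JE k + ennreal (real k / real N) * JE k = JE k" if "k < Suc N" for k
    proof -
      have "ennreal (1 - real k / real N) + ennreal (real k / real N) = 1"
        using that Npos by (subst ennreal_plus[symmetric]) auto
      then show ?thesis by (metis distrib_right mult_1)
    qed
    ultimately show ?thesis
      by (simp only: sum.distrib[symmetric]) (intro sum.cong, auto)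
  qed
  have odd: "(\<Sum>k<N. ennreal (1 - real k / real N) * Q k) + (\<Sum>k<N. ennreal ((real k + 1) / real N) * Q k)
      = (\<Sum>k<N. JO k)"
    unfolding sum.distrib[symmetric] distrib_right[symmetric]
    by (intro sum.cong refl) (simp add: coefs QJ)
  have "(\<integral>\<^sup>+z. g (fst z) + g (snd z) \<partial>half_coupling)
      = (\<Sum>k<M. ST k)
        + (\<Sum>k<Suc N. JE k) + (\<Sum>k<N. JO k)"
    unfolding even[symmetric] odd[symmetric]
    by (subst nn_integral_half_coupling) (simp_all add: S R F distrib_left sum.distrib add_ac)
  also have "\<dots> = J 0 1"
  proof -
    have glue: "J x y + J y z = J x z" if "x \<le> y" "y \<le> z" for x y z
      using set_nn_integral_Icc_add[OF g that] by (simp add: J_def)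
    have nv: "0 \<le> real N * v" using v by simp
    have a0: "0 \<le> a" unfolding a_eq using h v by simp
    have telescope: "(\<Sum>k<n. J (X k) (X (Suc k))) = J 0 (X n)" for n
    proof (induction n)
      case 0
      have "J 0 0 = (\<integral>\<^sup>+t. 0 \<partial>(lborel :: real measure))"
        unfolding J_def
        by (rule nn_integral_cong_AE)
          (use AE_lborel_singleton[of "0::real"] in \<open>eventually_elim, auto simp: indicator_def\<close>)
      then show ?case by (simp add: X_def)
    next
      case (Suc n)
      then show ?case using a0 by (simp add: glue XS) (simp add: glue X_def)
    qed
    show ?thesis
      using layout
    proof (elim disjE conjE)
      assume l: "M = N" "e = real N * v" "b = 0" "\<delta> = a + v / 2"
      have period: "ST k + JE k + JO k = J (X k) (X (Suc k))" for k
      proof -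
        have "JE k = J (X k) (X k + e)" by (simp add: JE_def l)
        moreover have "JO k = J (X k + e + h) (X k + e + \<delta>)"
        proof -
          have "X k + b + (a - v / 2) = X k + e + h" "X k + b + (a - v / 2) + (real N + 1) * v = X k + e + \<delta>"
            unfolding l a_eq by (simp_all add: field_simps)
          then show ?thesis by (simp only: JO_def)
        qed
        moreover have "X (Suc k) = X k + e + \<delta> + h"
          unfolding l XS a_eq by (simp add: field_simps)
        moreover have "e \<ge> 0" "h \<le> \<delta>" using nv v h unfolding l a_eq by (simp_all add: field_simps)
        ultimately show ?thesis
          using h glue[of "X k" "X k + e" "X k + e + h"] glue[of "X k" "X k + e + h" "X k + e + \<delta>"]
            glue[of "X k" "X k + e + \<delta>" "X k + e + \<delta> + h"]
          by (simp add: ST_def) (metis add.assoc add.commute)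
      qed
      have "X N + real N * v = 1"
        using total unfolding l X_def a_eq by (simp add: algebra_simps add_divide_distrib)
      then have "JE N = J (X N) 1" by (simp add: JE_def l)
      moreover have "X N \<ge> 0" "X N \<le> 1" using a0 \<open>X N + real N * v = 1\<close> nv by (simp_all add: X_def)
      moreover have "(\<Sum>k<N. ST k) + (\<Sum>k<N. JE k) + (\<Sum>k<N. JO k) = J 0 (X N)"
        unfolding telescope[symmetric] period[symmetric] by (simp only: sum.distrib)
      moreover have "(\<Sum>k<M. ST k) + (\<Sum>k<Suc N. JE k) + (\<Sum>k<N. JO k)
          = ((\<Sum>k<N. ST k) + (\<Sum>k<N. JE k) + (\<Sum>k<N. JO k)) + JE N"
        unfolding l(1) sum.lessThan_Suc by (simp only: add_ac)
      ultimately show ?thesis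
        using glue[of 0 "X N" 1] by simp
    next
      assume r: "M = N + 1" "e = 0" "b = h" "\<delta> = a - v / 2"
      have part: "ST k + JE k = J (X k) (X k + \<delta> + h)"
        for k
      proof -
        have "JE k = J (X k + h) (X k + \<delta>)"
        proof -
          have "X k + b = X k + h" "X k + b + real N * v = X k + \<delta>"
            unfolding r a_eq by (simp_all add: field_simps)
          then show ?thesis by (simp only: JE_def)
        qed
        moreover have "h \<le> \<delta>" using nv v h unfolding r a_eq by (simp add: field_simps)
        ultimately show ?thesis
          using h glue[of "X k" "X k + h" "X k + \<delta>"] glue[of "X k" "X k + \<delta>" "X k + \<delta> + h"]
          by (simp add: ST_def r(2)) (metis add.assoc add.commute)
      qed
      have dh: "\<delta> + h \<ge> 0" "\<delta> + h + (real N + 1) * v = 2 * a"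
        using nv v h unfolding r a_eq by (simp_all add: field_simps)
      have period: "J (X k) (X k + \<delta> + h) + JO k = J (X k) (X (Suc k))" for k
      proof -
        have "JO k = J (X k + \<delta> + h) (X (Suc k))"
        proof -
          have "X k + b + (a - v / 2) = X k + \<delta> + h"
              "X k + b + (a - v / 2) + (real N + 1) * v = X (Suc k)"
            using dh(2) unfolding r XS by (simp_all add: field_simps)
          then show ?thesis by (simp only: JO_def)
        qed
        moreover have "X k + \<delta> + h \<le> X (Suc k)"
          unfolding XS dh(2)[symmetric] using v by simp
        ultimately show ?thesis
          using dh(1) glue[of "X k" "X k + \<delta> + h" "X (Suc k)"] by simp
      qed
      have "X N + \<delta> + h = 1"
        using total unfolding r X_def a_eq by (simp add: algebra_simps add_divide_distrib)
      moreover have "X N \<ge> 0" using a0 by (simp add: X_def)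
      moreover have "(\<Sum>k<N. ST k) + (\<Sum>k<N. JE k) + (\<Sum>k<N. JO k) = J 0 (X N)"
        unfolding telescope[symmetric] period[symmetric] part[symmetric] by (simp only: sum.distrib)
      moreover have "(\<Sum>k<M. ST k) + (\<Sum>k<Suc N. JE k) + (\<Sum>k<N. JO k)
          = ((\<Sum>k<N. ST k) + (\<Sum>k<N. JE k) + (\<Sum>k<N. JO k)) + (ST N + JE N)"
        unfolding r(1) Suc_eq_plus1[symmetric] sum.lessThan_Suc by (simp only: add_ac)
      ultimately show ?thesis
        using glue[of 0 "X N" 1] dh(1) by (simp add: part)
    qed
  qed
  finally show ?thesis by (simp add: J_def)
qed

lemma coupling_uniform: "uniform01 coupling fst" "uniform01 coupling snd"
proof -
  have m: "fst \<in> borel_measurable coupling" "snd \<in> borel_measurable coupling"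
    by (auto intro!: borel_measurable_of_sets_eq)
  show "uniform01 coupling fst"
  proof (rule uniform01I_nn_integral[OF m(1)])
    fix g :: "real \<Rightarrow> ennreal" assume [measurable]: "g \<in> borel_measurable borel"
    show "(\<integral>\<^sup>+z. g (fst z) \<partial>coupling) = (\<integral>\<^sup>+t\<in>{0..1}. g t \<partial>lborel)"
      by (subst nn_integral_coupling) (simp_all add: half_coupling_margins)
  qed
  show "uniform01 coupling snd"
  proof (rule uniform01I_nn_integral[OF m(2)])
    fix g :: "real \<Rightarrow> ennreal" assume [measurable]: "g \<in> borel_measurable borel"
    show "(\<integral>\<^sup>+z. g (snd z) \<partial>coupling) = (\<integral>\<^sup>+t\<in>{0..1}. g t \<partial>lborel)"
      by (subst nn_integral_coupling) (simp_all add: half_coupling_margins add.commute)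
  qed
qed

text \<open>The coupling lives on the rungs and their mirror images.\<close>

lemma AE_coupling:
  assumes meas: "{z. P z} \<in> sets borel" and sym: "\<And>x y. P (x, y) \<Longrightarrow> P (y, x)"
    and straight: "\<And>k s. 0 \<le> s \<Longrightarrow> s \<le> h \<Longrightarrow> P (straight k s)"
    and rising: "\<And>k t. 0 \<le> t \<Longrightarrow> t \<le> real N * v \<Longrightarrow> P (rising k t)"
    and falling: "\<And>k t. 0 \<le> t \<Longrightarrow> t \<le> real N * v \<Longrightarrow> P (falling k t)"
  shows "AE z in coupling. P z"
proof -
  define f :: "real \<times> real \<Rightarrow> ennreal" where "f = indicator (- {z. P z})"
  have [measurable]: "f \<in> borel_measurable borel"
    using meas by (simp add: f_def)
  have z: "f z = 0 \<longleftrightarrow> P z" for z by (simp add: f_def indicator_def)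
  have fs: "f (y, x) = f (x, y)" for x y using sym by (auto simp: f_def indicator_def)
  have zero: "(\<integral>\<^sup>+t\<in>{0..c}. f (F t) \<partial>lborel) = 0" if "\<And>t. 0 \<le> t \<Longrightarrow> t \<le> c \<Longrightarrow> P (F t)" for F and c :: real
  proof -
    have "f (F t) * indicator {0..c} t = 0" for t
      using that[of t] z by (cases "t \<in> {0..c}") auto
    then have "(\<integral>\<^sup>+t\<in>{0..c}. f (F t) \<partial>lborel) = (\<integral>\<^sup>+t. 0 \<partial>(lborel :: real measure))"
      by (intro nn_integral_cong)
    then show ?thesis by simp
  qed
  have "(\<integral>\<^sup>+z. f z \<partial>coupling) = 0"
    using straight rising falling
    by (simp add: nn_integral_coupling_symmetric[of f, OF _ fs] nn_integral_half_coupling zero)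
  then have "AE z in coupling. f z = 0"
    by (subst (asm) nn_integral_0_iff_AE) (auto intro: borel_measurable_of_sets_eq)
  then show ?thesis by (simp add: z)
qed

lemma a_bounds: "a > 0" "(2 * real N + 1) * v / 2 \<le> a" "v / 2 \<le> a"
proof -
  have "a = h + real N * v + v / 2" by (simp add: a_eq field_simps)
  then show "v / 2 \<le> a" using h v by simp
  show "(2 * real N + 1) * v / 2 \<le> a" using h by (simp add: a_eq)
  have "h > 0 \<or> v > 0" using total h v by (cases "h = 0"; cases "v = 0") auto
  then show "a > 0" unfolding a_eq
  proof
    assume "v > 0"
    then have "(2 * real N + 1) * v / 2 > 0" by simp
    with h show "h + (2 * real N + 1) * v / 2 > 0" by simp
  qed (use v in \<open>simp add: add_pos_nonneg\<close>)
qed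

text \<open>Complementary slackness: the caps are centred so that the dual potential is tight on every rung.\<close>

lemma coupling_tight:
  "AE z in coupling. dual_potential N v a (b + real N * v / 2) (fst z)
      + dual_potential N v a (b + real N * v / 2) (snd z) = (\<bar>fst z - snd z\<bar> - a)\<^sup>2"
proof (rule AE_coupling)
  define c where "c = b + real N * v / 2"
  have n: "real N > 0" using N by simp
  show "{z. dual_potential N v a (b + real N * v / 2) (fst z)
      + dual_potential N v a (b + real N * v / 2) (snd z) = (\<bar>fst z - snd z\<bar> - a)\<^sup>2} \<in> sets borel"
    by measurable
  fix k
  note half_le = a_bounds(3)
  { fix s assume s: "0 \<le> s" "s \<le> h"
    show "dual_potential N v a (b + real N * v / 2) (fst (straight k s))
      + dual_potential N v a (b + real N * v / 2) (snd (straight k s)) = (\<bar>fst (straight k s) - snd (straight k s)\<bar> - a)\<^sup>2"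
      using layout
    proof (elim disjE conjE)
      have gap: "\<bar>fst (straight k s) - snd (straight k s)\<bar> = \<bar>\<delta>\<bar>" by (simp add: straight_def)
      assume l: "M = N" "e = real N * v" "b = 0" "\<delta> = a + v / 2"
      have pts: "straight k s = (c + 2 * a * of_int (int k) + 1 * (real N * v / 2 + s),
          c + 2 * a * of_int (int k) + a + 1 * ((real N + 1) * v / 2 + s))"
        unfolding straight_def unfolding l c_def by (simp add: field_simps)
      have dist: "\<bar>fst (straight k s) - snd (straight k s)\<bar> - a = v / 2"
        using a_bounds v gap by (simp add: l(4))
      have "s \<le> a - (2 * real N + 1) * v / 2" using s a_eq by simp
      then show ?thesis
        unfolding dist unfolding pts c_def[symmetric] fst_conv snd_conv
        by (intro dual_potential_tight_straight[OF n v a_bounds(1,2)] s) simp_all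
    next
      have gap: "\<bar>fst (straight k s) - snd (straight k s)\<bar> = \<bar>\<delta>\<bar>" by (simp add: straight_def)
      assume r: "M = N + 1" "e = 0" "b = h" "\<delta> = a - v / 2"
      \<comment> \<open>Here the block of length \<open>h\<close> precedes the cap, so its parameter is measured from the far end.\<close>
      have pts: "straight k s = (c + 2 * a * of_int (int k) + (-1) * (real N * v / 2 + (h - s)),
          c + 2 * a * of_int (int k) + a + (-1) * ((real N + 1) * v / 2 + (h - s)))"
        unfolding straight_def unfolding r c_def by (simp add: field_simps)
      have dist: "\<bar>fst (straight k s) - snd (straight k s)\<bar> - a = - (v / 2)"
        using half_le gap by (simp add: r(4))
      have "0 \<le> h - s" "h - s \<le> a - (2 * real N + 1) * v / 2" using s a_eq by simp_all
      then show ?thesis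
        unfolding dist power2_minus unfolding pts c_def[symmetric] fst_conv snd_conv
        by (intro dual_potential_tight_straight[OF n v a_bounds(1,2)]) simp_all
    qed }
  fix t assume t: "0 \<le> t" "t \<le> real N * v"
  define r where "r = t - real N * v / 2"
  have r: "\<bar>r\<bar> \<le> real N * v / 2" "r / real N = t / real N - v / 2"
    using t n by (auto simp: r_def field_simps)
  have tN: "0 \<le> t / real N" "t / real N \<le> v" using t n by (simp_all add: field_simps)
  have rise: "rising k t = (c + 2 * a * of_int (int k) + r, c + 2 * a * of_int (int k) + a + (r + r / real N))"
    unfolding rising_def c_def r(2) by (simp add: r_def)
  have fall: "falling k t = (c + 2 * a * of_int (int k) + a + (r + r / real N), c + 2 * a * of_int (int k + 1) + r)"
    unfolding falling_def c_def r(2) by (simp add: r_def algebra_simps)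
  have dist: "\<bar>fst (rising k t) - snd (rising k t)\<bar> - a = r / real N"
      "\<bar>fst (falling k t) - snd (falling k t)\<bar> - a = - (r / real N)"
    unfolding r(2) using tN half_le by (simp_all add: rising_def falling_def algebra_simps)
  show "dual_potential N v a (b + real N * v / 2) (fst (rising k t))
      + dual_potential N v a (b + real N * v / 2) (snd (rising k t)) = (\<bar>fst (rising k t) - snd (rising k t)\<bar> - a)\<^sup>2"
    unfolding dist unfolding rise c_def[symmetric] fst_conv snd_conv
    by (rule dual_potential_tight_sloped[OF n v a_bounds(1,2) r(1)])
  show "dual_potential N v a (b + real N * v / 2) (fst (falling k t))
      + dual_potential N v a (b + real N * v / 2) (snd (falling k t)) = (\<bar>fst (falling k t) - snd (falling k t)\<bar> - a)\<^sup>2"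
    unfolding dist unfolding fall c_def[symmetric] fst_conv snd_conv
    using dual_potential_tight_sloped[OF n v a_bounds(1,2) r(1), of c "int k + 1" "int k"]
    by (simp add: add.commute)
qed (auto simp: add.commute abs_minus_commute)

lemma gap_continuous:
  "continuous_on UNIV (\<lambda>z :: real \<times> real. (\<bar>fst z - snd z\<bar> - a)\<^sup>2)"
  "continuous_on UNIV (\<lambda>z :: real \<times> real. \<bar>fst z - snd z\<bar>)"
  by (intro continuous_intros)+

text \<open>Weak duality.  Both margins of any two couplings are the same, so the expectation of the
potential at \<open>U\<close> plus that at \<open>V\<close> is the same for both; it is a lower bound for the cost of any
coupling and equals the cost of the ladder.\<close>

lemma coupling_optimal_shifted:
  assumes U: "uniform01 \<Omega> U" and V: "uniform01 \<Omega> V"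
  shows "(\<integral>z. (\<bar>fst z - snd z\<bar> - a)\<^sup>2 \<partial>coupling) \<le> (\<integral>\<omega>. (\<bar>U \<omega> - V \<omega>\<bar> - a)\<^sup>2 \<partial>\<Omega>)"
proof -
  define f where "f = dual_potential N v a (b + real N * v / 2)"
  have n: "real N > 0" using N by simp
  have f_meas [measurable]: "f \<in> borel_measurable borel" by (simp add: f_def)
  obtain B where B: "\<And>u. \<bar>f u\<bar> \<le> B"
    using dual_potential_bounded[OF n v a_bounds(1)] unfolding f_def by blast
  note f_int = uniform01_integrable_bounded[OF _ f_meas B]
  have [measurable]: "fst \<in> borel_measurable coupling" "snd \<in> borel_measurable coupling"
    using coupling_uniform by (auto simp: uniform01_def)
  have "(\<integral>z. (\<bar>fst z - snd z\<bar> - a)\<^sup>2 \<partial>coupling) = (\<integral>z. f (fst z) + f (snd z) \<partial>coupling)"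
    using coupling_tight by (intro integral_cong_AE) (auto simp: f_def elim!: eventually_mono)
  also have "\<dots> = (\<integral>\<omega>. f (U \<omega>) + f (V \<omega>) \<partial>\<Omega>)"
    using uniform01_integral_eq[OF U coupling_uniform(1) f_meas]
      uniform01_integral_eq[OF V coupling_uniform(2) f_meas]
    by (simp add: f_int U V coupling_uniform)
  also have "\<dots> \<le> (\<integral>\<omega>. (\<bar>U \<omega> - V \<omega>\<bar> - a)\<^sup>2 \<partial>\<Omega>)"
  proof (rule integral_mono)
    show "integrable \<Omega> (\<lambda>\<omega>. (\<bar>U \<omega> - V \<omega>\<bar> - a)\<^sup>2)"
      using uniform01_integrable_continuous[OF U V gap_continuous(1)] by simp
    show "integrable \<Omega> (\<lambda>\<omega>. f (U \<omega>) + f (V \<omega>))"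
      by (intro Bochner_Integration.integrable_add f_int U V)
    show "f (U \<omega>) + f (V \<omega>) \<le> (\<bar>U \<omega> - V \<omega>\<bar> - a)\<^sup>2" for \<omega>
      unfolding f_def by (rule dual_potential_feasible[OF n v a_bounds(1,2)])
  qed
  finally show ?thesis .
qed

text \<open>The law of the distance under the ladder: an atom at \<open>\<delta>\<close> of mass \<open>2 M h\<close>, and the rest spread by the
sloped rungs, whose weights add up to \<open>(N + 1) / 2\<close> for the rising and for the falling ones.\<close>

lemma nn_integral_coupling_gap:
  fixes \<phi> :: "real \<Rightarrow> real"
  assumes [measurable]: "\<phi> \<in> borel_measurable borel" and nonneg: "\<And>x. x \<ge> 0 \<Longrightarrow> \<phi> x \<ge> 0" "I \<ge> 0"
    and rise: "(\<integral>\<^sup>+t\<in>{0..real N * v}. ennreal (\<phi> (a - v / 2 + t / real N)) \<partial>lborel) = ennreal I"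
    and fall: "(\<integral>\<^sup>+t\<in>{0..real N * v}. ennreal (\<phi> (a + v / 2 - t / real N)) \<partial>lborel) = ennreal I"
  shows "(\<integral>z. \<phi> \<bar>fst z - snd z\<bar> \<partial>coupling) = 2 * real M * h * \<phi> \<delta> + 2 * (real N + 1) * I"
proof -
  have n: "real N > 0" using N by simp
  note half_le = a_bounds(3)
  have \<delta>: "\<delta> \<ge> 0" using layout a_bounds(1) v half_le by auto
  have S: "(\<integral>\<^sup>+s\<in>{0..h}. ennreal (\<phi> \<bar>fst (straight k s) - snd (straight k s)\<bar>) \<partial>lborel) = ennreal (h * \<phi> \<delta>)" for k
    using \<delta> h nonneg(1) by (simp add: straight_def nn_integral_cmult_indicator ennreal_mult mult.commute)
  have R: "(\<integral>\<^sup>+t\<in>{0..real N * v}. ennreal (\<phi> \<bar>fst (rising k t) - snd (rising k t)\<bar>) \<partial>lborel) = ennreal I" for k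
    unfolding rise[symmetric]
  proof (intro nn_integral_cong)
    fix t :: real
    show "ennreal (\<phi> \<bar>fst (rising k t) - snd (rising k t)\<bar>) * indicator {0..real N * v} t
        = ennreal (\<phi> (a - v / 2 + t / real N)) * indicator {0..real N * v} t"
    proof (cases "t \<in> {0..real N * v}")
      case True
      then have "0 \<le> a - v / 2 + t / real N" using half_le n by (intro add_nonneg_nonneg) auto
      moreover have "snd (rising k t) - fst (rising k t) = a - v / 2 + t / real N"
        by (simp add: rising_def)
      ultimately show ?thesis by (simp add: abs_minus_commute)
    qed simp
  qed
  have F: "(\<integral>\<^sup>+t\<in>{0..real N * v}. ennreal (\<phi> \<bar>fst (falling k t) - snd (falling k t)\<bar>) \<partial>lborel) = ennreal I" for k
    unfolding fall[symmetric]
  proof (intro nn_integral_cong)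
    fix t :: real
    show "ennreal (\<phi> \<bar>fst (falling k t) - snd (falling k t)\<bar>) * indicator {0..real N * v} t
        = ennreal (\<phi> (a + v / 2 - t / real N)) * indicator {0..real N * v} t"
    proof (cases "t \<in> {0..real N * v}")
      case True
      then have "t / real N \<le> v" using n by (simp add: field_simps)
      then have "0 \<le> a + v / 2 - t / real N" using half_le by simp
      moreover have "snd (falling k t) - fst (falling k t) = a + v / 2 - t / real N"
        by (simp add: falling_def algebra_simps)
      ultimately show ?thesis by (simp add: abs_minus_commute)
    qed simp
  qed
  have "2 * (\<Sum>k<N. real k + 1) = real N * (real N + 1)"
    by (induction N) (auto simp: algebra_simps)
  then have sum_k: "(\<Sum>k<N. (real k + 1) / real N) = (real N + 1) / 2"
    using n by (simp add: sum_divide_distrib[symmetric] field_simps)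
  have "(\<Sum>k<N. 1 - real k / real N) = (\<Sum>k<N. (1 + 1 / real N) - (real k + 1) / real N)"
    by (simp add: add_divide_distrib)
  also have "\<dots> = (real N + 1) / 2"
    unfolding sum_subtractf sum_k using n by (simp add: field_simps)
  finally have sum_k': "(\<Sum>k<N. 1 - real k / real N) = (real N + 1) / 2" .
  have sum_R: "(\<Sum>k<N. ennreal (1 - real k / real N) * ennreal I) = ennreal ((real N + 1) / 2 * I)"
    unfolding sum_distrib_right[symmetric] using n nonneg(2)
    by (subst sum_ennreal) (auto simp: sum_k' ennreal_mult[symmetric])
  have sum_F: "(\<Sum>k<N. ennreal ((real k + 1) / real N) * ennreal I) = ennreal ((real N + 1) / 2 * I)"
    unfolding sum_distrib_right[symmetric] using n nonneg(2)
    by (subst sum_ennreal) (auto simp: sum_k ennreal_mult[symmetric])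
  have "(\<integral>\<^sup>+z. ennreal (\<phi> \<bar>fst z - snd z\<bar>) \<partial>coupling)
      = 2 * (of_nat M * ennreal (h * \<phi> \<delta>) + ennreal ((real N + 1) / 2 * I) + ennreal ((real N + 1) / 2 * I))"
    by (simp add: nn_integral_coupling_symmetric nn_integral_half_coupling abs_minus_commute S R F sum_R sum_F)
  also have "\<dots> = ennreal (2 * real M * h * \<phi> \<delta> + 2 * (real N + 1) * I)"
  proof -
    have double: "2 * (ennreal x + ennreal y + ennreal y) = ennreal (2 * (x + y + y))" if "x \<ge> 0" "y \<ge> 0" for x y
    proof -
      have "ennreal (2 * (x + y + y)) = ennreal 2 * ennreal (x + y + y)"
        by (rule ennreal_mult) (use that in auto)
      then show ?thesis
        using that by (simp only: ennreal_plus add_nonneg_nonneg ennreal_numeral zero_le_numeral)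
    qed
    have nn: "0 \<le> real M * (h * \<phi> \<delta>)" "0 \<le> (real N + 1) / 2 * I"
      using h nonneg \<delta> by auto
    have "of_nat M * ennreal (h * \<phi> \<delta>) = ennreal (real M * (h * \<phi> \<delta>))"
      using h nonneg \<delta> by (simp add: ennreal_mult ennreal_of_nat_eq_real_of_nat)
    then have "2 * (of_nat M * ennreal (h * \<phi> \<delta>) + ennreal ((real N + 1) / 2 * I) + ennreal ((real N + 1) / 2 * I))
        = ennreal (2 * (real M * (h * \<phi> \<delta>) + (real N + 1) / 2 * I + (real N + 1) / 2 * I))"
      by (simp only: double[OF nn])
    also have "2 * (real M * (h * \<phi> \<delta>) + (real N + 1) / 2 * I + (real N + 1) / 2 * I)
        = 2 * real M * h * \<phi> \<delta> + 2 * (real N + 1) * I"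
      by (simp add: field_simps)
    finally show ?thesis .
  qed
  finally have nn: "(\<integral>\<^sup>+z. ennreal (\<phi> \<bar>fst z - snd z\<bar>) \<partial>coupling)
      = ennreal (2 * real M * h * \<phi> \<delta> + 2 * (real N + 1) * I)" .
  have "(\<lambda>z. \<phi> \<bar>fst z - snd z\<bar>) \<in> borel_measurable coupling"
    by (rule borel_measurable_of_sets_eq) simp_all
  then have "(\<integral>z. \<phi> \<bar>fst z - snd z\<bar> \<partial>coupling) = enn2real (\<integral>\<^sup>+z. ennreal (\<phi> \<bar>fst z - snd z\<bar>) \<partial>coupling)"
    by (rule integral_eq_nn_integral) (simp add: nonneg(1))
  moreover have "0 \<le> 2 * real M * h * \<phi> \<delta> + 2 * (real N + 1) * I"
    using nonneg h \<delta> by simp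
  ultimately show ?thesis
    by (simp only: nn enn2real_ennreal)
qed

lemma coupling_mean_gap:
  "(\<integral>z. \<bar>fst z - snd z\<bar> \<partial>coupling) = 2 * real M * h * \<delta> + 2 * real N * (real N + 1) * (v * a)"
proof -
  have n: "real N > 0" using N by simp
  note half_le = a_bounds(3)
  have "(\<integral>z. \<bar>fst z - snd z\<bar> \<partial>coupling) = 2 * real M * h * \<delta> + 2 * (real N + 1) * (real N * v * a)"
  proof (rule nn_integral_coupling_gap[where \<phi> = "\<lambda>x. x"])
    have "(\<integral>\<^sup>+t\<in>{0..real N * v}. ennreal (a - v / 2 + t / real N) \<partial>lborel)
        = ennreal (((a - v / 2) * (real N * v) + (real N * v)\<^sup>2 / (2 * real N)) - ((a - v / 2) * 0 + 0\<^sup>2 / (2 * real N)))"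
    proof (intro nn_integral_FTC_Icc)
      fix t assume "t \<in> {0..real N * v}"
      then show "0 \<le> a - v / 2 + t / real N" using half_le n by (intro add_nonneg_nonneg) auto
    qed (use n v in \<open>auto intro!: derivative_eq_intros simp: field_simps\<close>)
    then show "(\<integral>\<^sup>+t\<in>{0..real N * v}. ennreal (a - v / 2 + t / real N) \<partial>lborel) = ennreal (real N * v * a)"
      using n by (simp add: field_simps power2_eq_square)
    have "(\<integral>\<^sup>+t\<in>{0..real N * v}. ennreal (a + v / 2 - t / real N) \<partial>lborel)
        = ennreal (((a + v / 2) * (real N * v) - (real N * v)\<^sup>2 / (2 * real N)) - ((a + v / 2) * 0 - 0\<^sup>2 / (2 * real N)))"
    proof (intro nn_integral_FTC_Icc)
      fix t assume "t \<in> {0..real N * v}"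
      then have "t / real N \<le> v" using n by (simp add: field_simps)
      then show "0 \<le> a + v / 2 - t / real N" using half_le by simp
    qed (use n v in \<open>auto intro!: derivative_eq_intros simp: field_simps\<close>)
    then show "(\<integral>\<^sup>+t\<in>{0..real N * v}. ennreal (a + v / 2 - t / real N) \<partial>lborel) = ennreal (real N * v * a)"
      using n by (simp add: field_simps power2_eq_square)
  qed (use v a_bounds(1) in auto)
  then show ?thesis by (simp add: algebra_simps)
qed

lemma coupling_shifted_second_moment:
  "(\<integral>z. (\<bar>fst z - snd z\<bar> - a)\<^sup>2 \<partial>coupling) = real M * h * v\<^sup>2 / 2 + real N * (real N + 1) * v ^ 3 / 6"
proof -
  have n: "real N > 0" using N by simp
  have "(\<integral>z. (\<bar>fst z - snd z\<bar> - a)\<^sup>2 \<partial>coupling) = 2 * real M * h * (\<delta> - a)\<^sup>2 + 2 * (real N + 1) * (real N * v ^ 3 / 12)"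
  proof (rule nn_integral_coupling_gap[where \<phi> = "\<lambda>x. (x - a)\<^sup>2"])
    have "(\<integral>\<^sup>+t\<in>{0..real N * v}. ennreal ((t / real N - v / 2)\<^sup>2) \<partial>lborel)
        = ennreal ((real N * v / real N - v / 2) ^ 3 * real N / 3 - (0 / real N - v / 2) ^ 3 * real N / 3)"
      using n v by (intro nn_integral_FTC_Icc)
        (auto intro!: derivative_eq_intros)
    also have "(real N * v / real N - v / 2) ^ 3 * real N / 3 - (0 / real N - v / 2) ^ 3 * real N / 3 = real N * v ^ 3 / 12"
      using n by (simp add: power3_eq_cube)
    finally show "(\<integral>\<^sup>+t\<in>{0..real N * v}. ennreal ((a - v / 2 + t / real N - a)\<^sup>2) \<partial>lborel) = ennreal (real N * v ^ 3 / 12)"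
      by (simp add: algebra_simps)
    then show "(\<integral>\<^sup>+t\<in>{0..real N * v}. ennreal ((a + v / 2 - t / real N - a)\<^sup>2) \<partial>lborel) = ennreal (real N * v ^ 3 / 12)"
      by (simp add: power2_eq_square algebra_simps)
  qed (use v in auto)
  moreover have "(\<delta> - a)\<^sup>2 = v\<^sup>2 / 4"
    using layout by (auto simp: power2_eq_square)
  ultimately show ?thesis by (simp add: field_simps)
qed

text \<open>For a prescribed mean distance, minimising the second moment and minimising the expected cost
\<open>(\<bar>U - V\<bar> - a)\<^sup>2\<close> are the same problem.\<close>

lemma second_moment_via_shift:
  assumes U: "uniform01 \<Omega> U" and V: "uniform01 \<Omega> V"
  shows "(\<integral>\<omega>. (U \<omega> - V \<omega>)\<^sup>2 \<partial>\<Omega>)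
    = (\<integral>\<omega>. (\<bar>U \<omega> - V \<omega>\<bar> - a)\<^sup>2 \<partial>\<Omega>) + 2 * a * (\<integral>\<omega>. \<bar>U \<omega> - V \<omega>\<bar> \<partial>\<Omega>) - a\<^sup>2"
proof -
  interpret prob_space \<Omega> using U by (rule uniform01_prob_space)
  have 1: "integrable \<Omega> (\<lambda>\<omega>. (\<bar>U \<omega> - V \<omega>\<bar> - a)\<^sup>2)"
    using uniform01_integrable_continuous[OF U V gap_continuous(1)] by simp
  have 2: "integrable \<Omega> (\<lambda>\<omega>. \<bar>U \<omega> - V \<omega>\<bar>)"
    using uniform01_integrable_continuous[OF U V gap_continuous(2)] by simp
  have "(\<integral>\<omega>. (U \<omega> - V \<omega>)\<^sup>2 \<partial>\<Omega>) = (\<integral>\<omega>. (\<bar>U \<omega> - V \<omega>\<bar> - a)\<^sup>2 + 2 * a * \<bar>U \<omega> - V \<omega>\<bar> - a\<^sup>2 \<partial>\<Omega>)"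
  proof (intro Bochner_Integration.integral_cong refl)
    fix \<omega>
    have "(U \<omega> - V \<omega>)\<^sup>2 = \<bar>U \<omega> - V \<omega>\<bar>\<^sup>2" by simp
    then show "(U \<omega> - V \<omega>)\<^sup>2 = (\<bar>U \<omega> - V \<omega>\<bar> - a)\<^sup>2 + 2 * a * \<bar>U \<omega> - V \<omega>\<bar> - a\<^sup>2"
      unfolding power2_diff by simp
  qed
  then show ?thesis using 1 2 by (simp add: prob_space)
qed

lemma coupling_mean:
  "(\<integral>z. \<bar>fst z - snd z\<bar> \<partial>coupling) = a + (\<delta> - a) * (1 - 2 * (real N * (real N + 1)) * v)"
proof -
  have *: "2 * real M * h = 1 - 2 * (real N * (real N + 1)) * v"
    using total by (simp add: algebra_simps)
  show ?thesis
    unfolding coupling_mean_gap * by (simp add: algebra_simps)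
qed

lemma coupling_second_moment:
  "(\<integral>z. (fst z - snd z)\<^sup>2 \<partial>coupling) = (\<integral>z. \<bar>fst z - snd z\<bar> \<partial>coupling)\<^sup>2
     + 2 * (real N * (real N + 1)) * v ^ 3 / 3 - (real N * (real N + 1) * v\<^sup>2)\<^sup>2"
proof -
  define W where "W = real N * (real N + 1)"
  have *: "real M * h = (1 - 2 * W * v) / 2"
    using total by (simp add: W_def algebra_simps)
  have sq: "(\<delta> - a)\<^sup>2 = v\<^sup>2 / 4" using layout by (auto simp: power2_eq_square)
  have "(a + (\<delta> - a) * (1 - 2 * W * v))\<^sup>2 = a\<^sup>2 + 2 * a * (\<delta> - a) * (1 - 2 * W * v) + (\<delta> - a)\<^sup>2 * (1 - 2 * W * v)\<^sup>2"
    by (simp add: power2_sum power_mult_distrib)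
  then show ?thesis
    unfolding second_moment_via_shift[OF coupling_uniform] coupling_shifted_second_moment
      coupling_mean W_def[symmetric] * sq
    by (simp add: power2_eq_square power3_eq_cube algebra_simps add_divide_distrib diff_divide_distrib)
qed

lemma coupling_optimal:
  assumes U: "uniform01 \<Omega> U" and V: "uniform01 \<Omega> V"
    and mean: "(\<integral>\<omega>. \<bar>U \<omega> - V \<omega>\<bar> \<partial>\<Omega>) = (\<integral>z. \<bar>fst z - snd z\<bar> \<partial>coupling)"
  shows "(\<integral>z. (fst z - snd z)\<^sup>2 \<partial>coupling) \<le> (\<integral>\<omega>. (U \<omega> - V \<omega>)\<^sup>2 \<partial>\<Omega>)"
  unfolding second_moment_via_shift[OF coupling_uniform] second_moment_via_shift[OF U V] mean
  using coupling_optimal_shifted[OF U V] by simp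

end

section \<open>The gap between a mean and its nearest endpoint\<close>

lemma index_interval_unique:
  assumes "N \<ge> 1" "m \<in> {1 / (2 * real N + 2)<..1 / (2 * real N)}"
    and "N' \<ge> 1" "m \<in> {1 / (2 * real N' + 2)<..1 / (2 * real N')}"
  shows "N' = N"
proof -
  have *: "\<not> k < l" if "k \<ge> 1" "1 / (2 * real k + 2) < m" "m \<le> 1 / (2 * real l)" for k l
  proof
    assume "k < l"
    then have "1 / (2 * real l) \<le> 1 / (2 * real k + 2)"
      using that(1) by (intro divide_left_mono) auto
    with that show False by linarith
  qed
  from assms show ?thesis
    using *[of N N'] *[of N' N] by (simp add: not_less)
qed

lemma Vmin_index_eq:
  assumes "N \<ge> 1" "m \<in> {1 / (2 * real N + 2)<..1 / (2 * real N)}"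
  shows "Vmin_index m = N"
  unfolding Vmin_index_def
  by (rule the_equality) (use assms in \<open>simp, blast intro: index_interval_unique[OF assms]\<close>)

lemma index_interval_exists:
  assumes "m \<in> {0<..1/2}"
  obtains N where "N \<ge> 1" "m \<in> {1 / (2 * real N + 2)<..1 / (2 * real N)}"
proof
  define k where "k = \<lfloor>1 / (2 * m)\<rfloor>"
  have m: "m > 0" "1 \<le> 1 / (2 * m)" using assms by (auto simp: field_simps)
  then have "1 \<le> k" unfolding k_def by (simp add: le_floor_iff)
  then show "nat k \<ge> 1" by simp
  have "real (nat k) = of_int k" using \<open>1 \<le> k\<close> by simp
  moreover have "of_int k \<le> 1 / (2 * m)" "1 / (2 * m) < of_int k + 1" unfolding k_def by linarith+
  ultimately show "m \<in> {1 / (2 * real (nat k) + 2)<..1 / (2 * real (nat k))}"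
    using m \<open>1 \<le> k\<close> by (simp add: field_simps)
qed

lemma cx_N_eq:
  assumes "N \<ge> 1" "m \<in> {1 / (2 * real N + 2)<..1 / (2 * real N)}"
  shows "cx_N (1 - 3 * m) = N"
proof -
  have "1 - 3 * m \<in> {1 - 3 / (2 * real k) ..< 1 - 3 / (2 * real k + 2)}
      \<longleftrightarrow> m \<in> {1 / (2 * real k + 2)<..1 / (2 * real k)}" for k
  proof -
    have "3 / (2 * real k) = 3 * (1 / (2 * real k))" "3 / (2 * real k + 2) = 3 * (1 / (2 * real k + 2))"
      by simp_all
    then show ?thesis unfolding atLeastLessThan_iff greaterThanAtMost_iff by linarith
  qed
  then show ?thesis
    unfolding cx_N_def
    by (intro the_equality) (use assms in \<open>simp, blast intro: index_interval_unique[OF assms]\<close>)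
qed

lemma Delta_eq:
  assumes "N \<ge> 1" "m \<in> {1 / (2 * real N + 2)<..1 / (2 * real N)}"
  shows "Delta m = min (m - 1 / (2 * real N + 2)) (1 / (2 * real N) - m)"
proof -
  let ?S = "{1 / (2 * real N + 2), 1 / (2 * real N)}" and ?f = "\<lambda>l. \<bar>m - l\<bar>"
  have "nearest_endpoint m = arg_min_on ?f ?S"
    unfolding nearest_endpoint_def Vmin_index_eq[OF assms] ..
  moreover have "arg_min_on ?f ?S \<in> ?S" by (rule arg_min_if_finite(1)) simp_all
  moreover have "\<not> (\<exists>x\<in>?S. ?f x < ?f (arg_min_on ?f ?S))" by (rule arg_min_if_finite(2)) simp_all
  ultimately have "nearest_endpoint m \<in> ?S" "\<forall>x\<in>?S. ?f (nearest_endpoint m) \<le> ?f x"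
    by (simp_all add: not_less)
  then show ?thesis
    using assms(2) unfolding Delta_def by auto
qed

lemma endpoint_distance:
  assumes "N \<ge> 1"
  shows "1 / (2 * real N) - 1 / (2 * real N + 2) = 1 / (2 * (real N * (real N + 1)))"
  using assms by (simp add: divide_simps)

text \<open>The quantity \<open>v\<close> of the construction, in a form that covers both halves of the interval: with
\<open>d = 2 N (N + 1)\<close> its two defining formulas read \<open>v = \<surd>(2 \<Delta> / d)\<close>.\<close>

definition gap_spread :: "real \<Rightarrow> real" where
  "gap_spread m = sqrt (Delta m / (real (Vmin_index m) * (real (Vmin_index m) + 1)))"

text \<open>The nearest endpoint is within a quarter of \<open>1 / (N (N + 1))\<close>, since the two endpoints are
\<open>1 / (2 N (N + 1))\<close> apart.  This is what keeps the straight rungs of nonnegative length.\<close>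

lemma gap_spread_properties:
  assumes N: "N \<ge> 1" "m \<in> {1 / (2 * real N + 2)<..1 / (2 * real N)}"
  shows "gap_spread m \<ge> 0" "real N * (real N + 1) * (gap_spread m)\<^sup>2 = Delta m"
    "2 * (real N * (real N + 1)) * gap_spread m \<le> 1"
    "(real N + 1) * gap_spread m \<le> 1 / (2 * real N)" "real N * gap_spread m \<le> 1 / (2 * real N + 2)"
proof -
  define W where "W = real N * (real N + 1)"
  have W: "W > 0" using N(1) by (simp add: W_def)
  have D: "0 \<le> Delta m" "2 * Delta m \<le> 1 / (2 * W)"
    using Delta_eq[OF N] N(2) endpoint_distance[OF N(1)] by (auto simp: W_def min_def)
  have s: "gap_spread m = sqrt (Delta m / W)"
    by (simp add: gap_spread_def W_def Vmin_index_eq[OF N])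
  show "gap_spread m \<ge> 0" using s D W by simp
  show "real N * (real N + 1) * (gap_spread m)\<^sup>2 = Delta m"
    using D W by (simp add: s W_def[symmetric])
  have "Delta m / W \<le> (1 / (2 * W))\<^sup>2"
    using D W by (simp add: field_simps power2_eq_square)
  then have le: "gap_spread m \<le> 1 / (2 * W)"
    unfolding s using W by (intro real_le_lsqrt) auto
  then show "2 * (real N * (real N + 1)) * gap_spread m \<le> 1"
    unfolding W_def[symmetric] using W by (simp add: field_simps)
  have "(real N + 1) * gap_spread m \<le> (real N + 1) * (1 / (2 * W))"
    using le by (intro mult_left_mono) auto
  also have "\<dots> = 1 / (2 * real N)" using N(1) by (simp add: W_def)
  finally show "(real N + 1) * gap_spread m \<le> 1 / (2 * real N)" .
  have "real N * gap_spread m \<le> real N * (1 / (2 * W))"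
    using le by (intro mult_left_mono) auto
  also have "\<dots> = 1 / (2 * real N + 2)" using N(1) by (simp add: W_def)
  finally show "real N * gap_spread m \<le> 1 / (2 * real N + 2)" .
qed

lemma Vmin_eq_gap_spread:
  assumes N: "N \<ge> 1" "m \<in> {1 / (2 * real N + 2)<..1 / (2 * real N)}"
  shows "Vmin m = 2 * (real N * (real N + 1)) * gap_spread m ^ 3 / 3 - (real N * (real N + 1) * (gap_spread m)\<^sup>2)\<^sup>2"
proof -
  define W v where "W = real N * (real N + 1)" and "v = gap_spread m"
  have W: "W > 0" using N(1) by (simp add: W_def)
  have v: "v \<ge> 0" "W * v\<^sup>2 = Delta m"
    using gap_spread_properties(1,2)[OF N] by (simp_all add: v_def W_def)
  have "m > 0" using N by (auto intro: less_trans[rotated])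
  then have "Vmin m = 2 * Delta m powr (3/2) / (3 * sqrt W) - (Delta m)\<^sup>2"
    by (simp add: Vmin_def Vmin_index_eq[OF N] W_def)
  moreover have "Delta m powr (3/2) = (W * v\<^sup>2) * (sqrt W * v)"
  proof -
    have "Delta m powr (3/2) = Delta m powr (1 + 1/2)" by simp
    also have "\<dots> = Delta m * sqrt (Delta m)"
      using v W unfolding powr_add by (simp add: powr_half_sqrt flip: v(2))
    also have "sqrt (Delta m) = sqrt W * v"
      using v(1) unfolding v(2)[symmetric] by (simp add: real_sqrt_mult)
    finally show ?thesis using v(2) by simp
  qed
  ultimately show ?thesis
    using W by (simp add: v(2)[symmetric] W_def[symmetric] v_def[symmetric] power2_eq_square power3_eq_cube)
qed

lemma Vmin_zero: "Vmin 0 = 0"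
  by (simp add: Vmin_def)

text \<open>With \<open>W = N (N + 1)\<close> and the spread \<open>v\<close> the excess factors as \<open>W v\<^sup>3 (2/3 - W v)\<close>, and \<open>W v \<le> 1/2\<close>.
So it vanishes only if \<open>v\<close> does, that is, at an endpoint.\<close>

lemma Vmin_nonneg_and_zero_iff:
  assumes m: "m \<in> {0..1/2}"
  shows "Vmin m \<ge> 0 \<and> (Vmin m = 0 \<longleftrightarrow> m \<in> crit_set)"
proof (cases "m = 0")
  case True
  then show ?thesis by (simp add: Vmin_zero crit_set_def)
next
  case False
  with m have "m \<in> {0<..1/2}" by simp
  then obtain N where N: "N \<ge> 1" "m \<in> {1 / (2 * real N + 2)<..1 / (2 * real N)}"
    by (rule index_interval_exists)
  define W v where "W = real N * (real N + 1)" and "v = gap_spread m"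
  have W: "W > 0" using N(1) by (simp add: W_def)
  have v: "v \<ge> 0" "W * v\<^sup>2 = Delta m" "2 * W * v \<le> 1"
    using gap_spread_properties(1-3)[OF N] by (simp_all add: v_def W_def)
  have V: "Vmin m = W * v ^ 3 * (2 / 3 - W * v)"
    unfolding Vmin_eq_gap_spread[OF N] W_def[symmetric] v_def[symmetric]
    by (simp add: power2_eq_square power3_eq_cube algebra_simps)
  have pos: "2 / 3 - W * v > 0" using v(3) by simp
  have "m \<in> crit_set \<longleftrightarrow> m = 1 / (2 * real N)"
  proof
    assume "m \<in> crit_set"
    then obtain k where k: "k \<ge> 1" "m = 1 / (2 * real k)"
      using False by (auto simp: crit_set_def)
    then have "m \<in> {1 / (2 * real k + 2)<..1 / (2 * real k)}"
      using \<open>m \<in> {0<..1/2}\<close> by (simp add: field_simps)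
    then show "m = 1 / (2 * real N)"
      using index_interval_unique[OF N k(1)] k(2) by simp
  qed (use N(1) in \<open>auto simp: crit_set_def\<close>)
  also have "\<dots> \<longleftrightarrow> Delta m = 0"
    using Delta_eq[OF N] N(2) by (auto simp: min_def)
  also have "\<dots> \<longleftrightarrow> Vmin m = 0"
    unfolding V v(2)[symmetric] using W pos by auto
  finally show ?thesis
    unfolding V using W v(1) pos by auto
qed

text \<open>By the triangle inequality through the median \<open>1/2\<close>, from which a uniform variable has mean distance
\<open>1/4\<close>.\<close>

lemma mean_gap_le_half:
  assumes U: "uniform01 \<Omega> U" and V: "uniform01 \<Omega> V"
  shows "(\<integral>\<omega>. \<bar>U \<omega> - V \<omega>\<bar> \<partial>\<Omega>) \<le> 1 / 2"
proof -
  have dev: "(\<integral>\<omega>. \<bar>X \<omega> - 1 / 2\<bar> \<partial>\<Omega>) = 1 / 4" if X: "uniform01 \<Omega> X" for X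
  proof -
    have [measurable]: "X \<in> borel_measurable \<Omega>" using X by (simp add: uniform01_def)
    have left: "(\<integral>\<^sup>+t\<in>{0..1/2}. ennreal \<bar>t - 1 / 2\<bar> \<partial>lborel) = ennreal (1 / 8)"
    proof -
      have "(\<integral>\<^sup>+t\<in>{0..1/2}. ennreal \<bar>t - 1 / 2\<bar> \<partial>lborel) = (\<integral>\<^sup>+t\<in>{0..1/2}. ennreal (1 / 2 - t) \<partial>lborel)"
        by (intro nn_integral_cong) (auto simp: indicator_def)
      also have "\<dots> = ennreal ((1/2 * (1/2) - (1/2)\<^sup>2 / 2) - (1/2 * 0 - 0\<^sup>2 / 2))"
        by (intro nn_integral_FTC_Icc) (auto intro!: derivative_eq_intros)
      finally show ?thesis by (simp add: power2_eq_square)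
    qed
    have right: "(\<integral>\<^sup>+t\<in>{1/2..1}. ennreal \<bar>t - 1 / 2\<bar> \<partial>lborel) = ennreal (1 / 8)"
    proof -
      have "(\<integral>\<^sup>+t\<in>{1/2..1}. ennreal \<bar>t - 1 / 2\<bar> \<partial>lborel) = (\<integral>\<^sup>+t\<in>{1/2..1}. ennreal (t - 1 / 2) \<partial>lborel)"
        by (intro nn_integral_cong) (auto simp: indicator_def)
      also have "\<dots> = ennreal ((1\<^sup>2 / 2 - 1/2 * 1) - ((1/2)\<^sup>2 / 2 - 1/2 * (1/2)))"
        by (intro nn_integral_FTC_Icc) (auto intro!: derivative_eq_intros)
      finally show ?thesis by (simp add: power2_eq_square)
    qed
    have "(\<integral>\<^sup>+\<omega>. ennreal \<bar>X \<omega> - 1 / 2\<bar> \<partial>\<Omega>) = (\<integral>\<^sup>+t\<in>{0..1}. ennreal \<bar>t - 1 / 2\<bar> \<partial>lborel)"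
      using X by (rule uniform01_nn_integral) measurable
    also have "\<dots> = (\<integral>\<^sup>+t\<in>{0..1/2}. ennreal \<bar>t - 1 / 2\<bar> \<partial>lborel) + (\<integral>\<^sup>+t\<in>{1/2..1}. ennreal \<bar>t - 1 / 2\<bar> \<partial>lborel)"
      by (subst set_nn_integral_Icc_add) auto
    also have "\<dots> = ennreal (1 / 8) + ennreal (1 / 8)"
      by (simp only: left right)
    also have "\<dots> = ennreal (1 / 4)"
      by (subst ennreal_plus[symmetric]) auto
    finally show ?thesis
      by (subst integral_eq_nn_integral) auto
  qed
  have int: "integrable \<Omega> (\<lambda>\<omega>. \<bar>U \<omega> - V \<omega>\<bar>)" "integrable \<Omega> (\<lambda>\<omega>. \<bar>U \<omega> - 1 / 2\<bar>)"
      "integrable \<Omega> (\<lambda>\<omega>. \<bar>V \<omega> - 1 / 2\<bar>)"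
    using uniform01_integrable_continuous[OF U V, of "\<lambda>z. \<bar>fst z - snd z\<bar>"]
      uniform01_integrable_continuous[OF U V, of "\<lambda>z. \<bar>fst z - 1 / 2\<bar>"]
      uniform01_integrable_continuous[OF U V, of "\<lambda>z. \<bar>snd z - 1 / 2\<bar>"]
    by (simp_all add: continuous_intros)
  have "(\<integral>\<omega>. \<bar>U \<omega> - V \<omega>\<bar> \<partial>\<Omega>) \<le> (\<integral>\<omega>. \<bar>U \<omega> - 1 / 2\<bar> + \<bar>V \<omega> - 1 / 2\<bar> \<partial>\<Omega>)"
    using int by (intro integral_mono) auto
  also have "\<dots> = 1 / 2"
    using int dev[OF U] dev[OF V] by simp
  finally show ?thesis .
qed

section \<open>The copulas as ladder couplings\<close>

lemma cx_parameters:
  assumes N: "N \<ge> 1" "m \<in> {1 / (2 * real N + 2)<..1 / (2 * real N)}"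
  defines "x \<equiv> 1 - 3 * m" and "L \<equiv> 1 / (2 * real N)" and "R \<equiv> 1 / (2 * real N + 2)"
  shows "cx_N x = N" "cx_L x = L" "cx_R x = R" "cx_m x = m" "cx_v x = gap_spread m"
    "cx_left x \<longleftrightarrow> (L + R) / 2 < m"
    "cx_p x * L = L - (real N + 1) * gap_spread m" "cx_p x * R = R - real N * gap_spread m"
    "Delta m = (if (L + R) / 2 < m then L - m else m - R)"
proof -
  define W where "W = real N * (real N + 1)"
  have W: "W > 0" using N(1) by (simp add: W_def)
  have LR: "R < m" "m \<le> L" using N(2) by (simp_all add: L_def R_def)
  show cxN: "cx_N x = N" unfolding x_def by (rule cx_N_eq[OF N])
  then show cxL: "cx_L x = L" and cxR: "cx_R x = R" by (simp_all add: cx_L_def cx_R_def L_def R_def)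
  show cxm: "cx_m x = m" by (simp add: cx_m_def x_def)
  have d: "cx_d x = 2 * W"
    using endpoint_distance[OF N(1)] by (simp add: cx_d_def cxL cxR L_def R_def W_def)
  show left: "cx_left x \<longleftrightarrow> (L + R) / 2 < m"
    unfolding cx_left_def cxL cxR unfolding x_def using LR by auto
  show D: "Delta m = (if (L + R) / 2 < m then L - m else m - R)"
    using Delta_eq[OF N] by (auto simp: L_def R_def min_def)
  have s: "gap_spread m = sqrt (Delta m / W)"
    by (simp add: gap_spread_def W_def Vmin_index_eq[OF N])
  show cv: "cx_v x = gap_spread m"
    unfolding cx_v_def left cxL cxR cxm d s D using W by (simp add: field_simps)
  have "2 * W * L = real N + 1" "2 * W * R = real N"
    using N(1) by (simp_all add: W_def L_def R_def field_simps)
  moreover have "cx_p x * l = l - (2 * W * l) * gap_spread m" for l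
    unfolding cx_p_def d cv by (simp add: algebra_simps)
  ultimately show "cx_p x * L = L - (real N + 1) * gap_spread m" "cx_p x * R = R - real N * gap_spread m"
    by simp_all
qed

text \<open>In both cases \<open>\<theta> = 2 a\<close> and the straight rungs have as their length the endpoint \<open>\<delta>\<close> nearest to \<open>m\<close>.  So
\<open>a = L - v / 2\<close> and \<open>a = R + v / 2\<close>, respectively, and the factor \<open>p\<close> that scales the
straight blocks makes their length \<open>h = a - (2 N + 1) v / 2\<close>.\<close>

lemma cx_pi_eq_coupling:
  assumes m: "m \<in> {0<..1/2}"
  obtains N M a v h e b \<delta> where "ladder N M a v h e b \<delta>" "cx_pi (1 - 3 * m) = ladder.coupling N M a v h e b \<delta>"
    "m = a + (\<delta> - a) * (1 - 2 * (real N * (real N + 1)) * v)"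
    "Vmin m = 2 * (real N * (real N + 1)) * v ^ 3 / 3 - (real N * (real N + 1) * v\<^sup>2)\<^sup>2"
proof -
  obtain N where N: "N \<ge> 1" "m \<in> {1 / (2 * real N + 2)<..1 / (2 * real N)}"
    using m by (rule index_interval_exists)
  define x L R v where "x = 1 - 3 * m" and "L = 1 / (2 * real N)" and "R = 1 / (2 * real N + 2)" and "v = gap_spread m"
  note cx = cx_parameters[OF N, folded x_def L_def R_def v_def]
  note v = gap_spread_properties[OF N, folded L_def R_def v_def]
  note V = Vmin_eq_gap_spread[OF N, folded v_def]
  have NL: "2 * real N * L = 1" and NR: "2 * (real N + 1) * R = 1"
    using N(1) by (simp_all add: L_def R_def field_simps)
  show thesis
  proof (cases "(L + R) / 2 < m")
    case True
    then have left: "cx_left x" and \<Delta>: "real N * (real N + 1) * v\<^sup>2 = L - m"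
      using cx v(2) by simp_all
    define a h where "a = L - v / 2" and "h = L - (real N + 1) * v"
    interpret ladder N N a v h "real N * v" 0 L
    proof
      show "2 * real N * h + 2 * real N * (real N + 1) * v = 1"
        using NL by (simp add: h_def algebra_simps)
    qed (use N v in \<open>simp_all add: a_def h_def algebra_simps add_divide_distrib\<close>)
    have theta: "cx_theta x = 2 * a" using left cx by (simp add: cx_theta_def a_def)
    have "cx_A_L x k = straight k" "cx_B_L x k = rising k" "cx_C_L x k = falling k" for k
      by (auto simp: cx_A_L_def straight_def cx_B_L_def rising_def cx_C_L_def falling_def cx_ell_L_def
          theta cx(1,2,5) fun_eq_iff) (simp_all add: a_def)
    then have "cx_pi x = coupling"
      unfolding cx_pi_def coupling_def cx_nu_def cx_nu_L_def half_coupling_def cx_alpha_def cx_beta_def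
      using left cx(1,2,5,7) by (simp add: h_def)
    moreover have "m = a + (L - a) * (1 - 2 * (real N * (real N + 1)) * v)"
      using \<Delta> by (simp add: a_def power2_eq_square algebra_simps)
    ultimately show thesis
      using that[OF ladder_axioms] V by (simp add: x_def)
  next
    case False
    then have right: "\<not> cx_left x" and \<Delta>: "real N * (real N + 1) * v\<^sup>2 = m - R"
      using cx v(2) by simp_all
    define a h where "a = R + v / 2" and "h = R - real N * v"
    interpret ladder N "N + 1" a v h 0 h R
    proof
      show "2 * real (N + 1) * h + 2 * real N * (real N + 1) * v = 1"
        using NR by (simp add: h_def algebra_simps)
    qed (use N v in \<open>simp_all add: a_def h_def algebra_simps add_divide_distrib\<close>)
    have theta: "cx_theta x = 2 * a" using right cx by (simp add: cx_theta_def a_def)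
    have "cx_A_R x k = straight k" "cx_B_R x k = rising k" "cx_C_R x k = falling k" for k
      by (auto simp: cx_A_R_def straight_def cx_B_R_def rising_def cx_C_R_def falling_def cx_ell_R_def
          theta cx(1,3,5,8) fun_eq_iff) (simp_all add: a_def h_def)
    then have "cx_pi x = coupling"
      unfolding cx_pi_def coupling_def cx_nu_def cx_nu_R_def half_coupling_def cx_alpha_def cx_beta_def
      using right cx(1,3,5,8) by (simp add: h_def atLeastLessThanSuc_atLeastAtMost)
    moreover have "m = a + (R - a) * (1 - 2 * (real N * (real N + 1)) * v)"
      using \<Delta> by (simp add: a_def power2_eq_square algebra_simps)
    ultimately show thesis
      using that[OF ladder_axioms] V by (simp add: x_def)
  qed
qed

lemma cx_pi_properties:
  assumes m: "m \<in> {0<..1/2}"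
  shows "sets (cx_pi (1 - 3 * m)) = sets borel"
    "uniform01 (cx_pi (1 - 3 * m)) fst" "uniform01 (cx_pi (1 - 3 * m)) snd"
    "(\<integral>z. \<bar>fst z - snd z\<bar> \<partial>cx_pi (1 - 3 * m)) = m"
    "(\<integral>z. (fst z - snd z)\<^sup>2 \<partial>cx_pi (1 - 3 * m)) = m\<^sup>2 + Vmin m"
    "\<And>\<Omega> U V. uniform01 \<Omega> U \<Longrightarrow> uniform01 \<Omega> V \<Longrightarrow> (\<integral>\<omega>. \<bar>U \<omega> - V \<omega>\<bar> \<partial>\<Omega>) = m \<Longrightarrow>
      m\<^sup>2 + Vmin m \<le> (\<integral>\<omega>. (U \<omega> - V \<omega>)\<^sup>2 \<partial>\<Omega>)"
proof -
  from m obtain N M a v h e b \<delta> where l: "ladder N M a v h e b \<delta>"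
    and pi: "cx_pi (1 - 3 * m) = ladder.coupling N M a v h e b \<delta>"
    and mean: "m = a + (\<delta> - a) * (1 - 2 * (real N * (real N + 1)) * v)"
    and V: "Vmin m = 2 * (real N * (real N + 1)) * v ^ 3 / 3 - (real N * (real N + 1) * v\<^sup>2)\<^sup>2"
    by (rule cx_pi_eq_coupling)
  interpret ladder N M a v h e b \<delta> by (rule l)
  have 1: "(\<integral>z. \<bar>fst z - snd z\<bar> \<partial>coupling) = m"
    using coupling_mean mean by simp
  have 2: "(\<integral>z. (fst z - snd z)\<^sup>2 \<partial>coupling) = m\<^sup>2 + Vmin m"
    using coupling_second_moment V unfolding 1 by simp
  show "sets (cx_pi (1 - 3 * m)) = sets borel"
    "uniform01 (cx_pi (1 - 3 * m)) fst" "uniform01 (cx_pi (1 - 3 * m)) snd"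
    "(\<integral>z. \<bar>fst z - snd z\<bar> \<partial>cx_pi (1 - 3 * m)) = m"
    "(\<integral>z. (fst z - snd z)\<^sup>2 \<partial>cx_pi (1 - 3 * m)) = m\<^sup>2 + Vmin m"
    unfolding pi using 1 2 coupling_uniform by simp_all
  show "m\<^sup>2 + Vmin m \<le> (\<integral>\<omega>. (U \<omega> - V \<omega>)\<^sup>2 \<partial>\<Omega>)"
    if "uniform01 \<Omega> U" "uniform01 \<Omega> V" "(\<integral>\<omega>. \<bar>U \<omega> - V \<omega>\<bar> \<partial>\<Omega>) = m" for \<Omega> U V
    using coupling_optimal[OF that(1,2)] that(3) unfolding 1 2 by simp
qed

text \<open>The margins have no mass below \<open>0\<close>, so the rectangles that define \<open>C\<^sub>x\<close> may be enlarged to quadrants.\<close>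

lemma Cx_eq_measure_cx_pi:
  assumes "m \<in> {0<..1/2}"
  shows "Cx (1 - 3 * m) u v = measure (cx_pi (1 - 3 * m)) ({..u} \<times> {..v})"
  unfolding Cx_def
proof (rule measure_eq_AE)
  note facts = cx_pi_properties[OF assms]
  show "AE z in cx_pi (1 - 3 * m). z \<in> {0..u} \<times> {0..v} \<longleftrightarrow> z \<in> {..u} \<times> {..v}"
    using uniform01_AE[OF facts(2)] uniform01_AE[OF facts(3)] by eventually_elim auto
  show "{0..u} \<times> {0..v} \<in> sets (cx_pi (1 - 3 * m))" "{..u} \<times> {..v} \<in> sets (cx_pi (1 - 3 * m))"
    unfolding facts(1) by (intro borel_closed closed_Times; simp)+
qed

lemma measure_is_copula:
  assumes "sets \<mu> = sets borel" "uniform01 \<mu> fst" "uniform01 \<mu> snd"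
    "\<And>u v. u \<in> {0..1} \<Longrightarrow> v \<in> {0..1} \<Longrightarrow> C u v = measure \<mu> ({..u} \<times> {..v})"
  shows "is_copula C"
  unfolding is_copula_def using assms uniform01_prob_space[OF assms(2)] by blast

lemma comonotone_measure:
  defines "\<mu> \<equiv> distr (uniform_measure lborel {0..1}) borel (\<lambda>x :: real. (x, x))"
  shows "sets \<mu> = sets borel" "uniform01 \<mu> fst" "uniform01 \<mu> snd"
    "\<And>u v. u \<in> {0..1} \<Longrightarrow> v \<in> {0..1} \<Longrightarrow> comonotonicity_copula u v = measure \<mu> ({..u} \<times> {..v})"
    "AE z in \<mu>. fst z = snd z"
proof -
  let ?U = "uniform_measure lborel {0..1} :: real measure"
  have [measurable]: "(\<lambda>x :: real. (x, x)) \<in> borel_measurable borel"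
    by (intro borel_measurable_continuous_onI continuous_intros)
  have [measurable]: "(\<lambda>x :: real. (x, x)) \<in> borel_measurable ?U"
    by (rule borel_measurable_of_sets_eq) simp_all
  show sets: "sets \<mu> = sets borel" by (simp add: \<mu>_def)
  have id: "distr ?U borel (\<lambda>x. x) = ?U"
    by (rule distr_id2) simp
  have m: "fst \<in> borel_measurable \<mu>" "snd \<in> borel_measurable \<mu>"
    by (auto simp: \<mu>_def)
  then show "uniform01 \<mu> fst" "uniform01 \<mu> snd"
    by (simp_all add: uniform01_def \<mu>_def distr_distr comp_def id)
  show "comonotonicity_copula u v = measure \<mu> ({..u} \<times> {..v})" if "u \<in> {0..1}" "v \<in> {0..1}" for u v
  proof -
    have [measurable]: "{..u} \<times> {..v} \<in> sets borel"
      by (intro borel_closed closed_Times) auto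
    have "measure \<mu> ({..u} \<times> {..v}) = measure ?U {..min u v}"
    proof -
      have "(\<lambda>x :: real. (x, x)) -` ({..u} \<times> {..v}) = {..min u v}" by auto
      then show ?thesis unfolding \<mu>_def by (simp add: measure_distr)
    qed
    also have "\<dots> = measure lborel ({0..1} \<inter> {..min u v})"
      by (simp add: measure_def emeasure_uniform_measure divide_ennreal_def)
    also have "{0..1} \<inter> {..min u v} = {0..min u v}" using that by auto
    finally show ?thesis using that by (simp add: comonotonicity_copula_def)
  qed
  show "AE z in \<mu>. fst z = snd z"
    unfolding \<mu>_def by (subst AE_distr_iff) auto
qed

section \<open>The sharp bound\<close>

theorem proposition1p6:
  shows
    "(\<forall>(\<Omega> :: 'a measure) U V m.
        prob_space \<Omega> \<and> uniform01 \<Omega> U \<and> uniform01 \<Omega> V \<and>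
        m = (\<integral>\<omega>. \<bar>U \<omega> - V \<omega>\<bar> \<partial>\<Omega>) \<longrightarrow>
        (\<integral>\<omega>. (U \<omega> - V \<omega>)\<^sup>2 \<partial>\<Omega>) \<ge> m\<^sup>2 + Vmin m)
     \<and>
     (\<forall>m \<in> {0 <.. 1/2}.
        is_copula (Cx (1 - 3 * m)) \<and>
        (\<forall>(\<Omega> :: 'a measure) U V.
           has_copula \<Omega> U V (Cx (1 - 3 * m)) \<longrightarrow>
           uniform01 \<Omega> U \<and> uniform01 \<Omega> V \<and>
           (\<integral>\<omega>. \<bar>U \<omega> - V \<omega>\<bar> \<partial>\<Omega>) = m \<and>
           (\<integral>\<omega>. (U \<omega> - V \<omega>)\<^sup>2 \<partial>\<Omega>) = m\<^sup>2 + Vmin m))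
     \<and>
     (is_copula comonotonicity_copula \<and>
        (\<forall>(\<Omega> :: 'a measure) U V.
           has_copula \<Omega> U V comonotonicity_copula \<longrightarrow>
           uniform01 \<Omega> U \<and> uniform01 \<Omega> V \<and>
           (\<integral>\<omega>. \<bar>U \<omega> - V \<omega>\<bar> \<partial>\<Omega>) = 0 \<and>
           (\<integral>\<omega>. (U \<omega> - V \<omega>)\<^sup>2 \<partial>\<Omega>) = 0\<^sup>2 + Vmin 0))
     \<and>
     (\<forall>m \<in> {0 .. 1/2}. Vmin m \<ge> 0 \<and> (Vmin m = 0 \<longleftrightarrow> m \<in> crit_set))"
proof (intro conjI allI impI ballI)
  fix \<Omega> :: "'a measure" and U V :: "'a \<Rightarrow> real" and m :: real
  assume "prob_space \<Omega> \<and> uniform01 \<Omega> U \<and> uniform01 \<Omega> V \<and> m = (\<integral>\<omega>. \<bar>U \<omega> - V \<omega>\<bar> \<partial>\<Omega>)"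
  then have U: "uniform01 \<Omega> U" and V: "uniform01 \<Omega> V" and m: "(\<integral>\<omega>. \<bar>U \<omega> - V \<omega>\<bar> \<partial>\<Omega>) = m"
    by auto
  have "0 \<le> m" "m \<le> 1 / 2"
    using mean_gap_le_half[OF U V] unfolding m[symmetric] by simp_all
  then consider "m = 0" | "m \<in> {0<..1/2}" by fastforce
  then show "m\<^sup>2 + Vmin m \<le> (\<integral>\<omega>. (U \<omega> - V \<omega>)\<^sup>2 \<partial>\<Omega>)"
    by cases (use cx_pi_properties(6)[OF _ U V m] in \<open>simp_all add: Vmin_zero\<close>)
next
  fix m :: real assume m: "m \<in> {0<..1/2}"
  note facts = cx_pi_properties[OF m] and Cx = Cx_eq_measure_cx_pi[OF m]
  show "is_copula (Cx (1 - 3 * m))"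
    by (rule measure_is_copula[OF facts(1-3) Cx])
  fix \<Omega> :: "'a measure" and U V :: "'a \<Rightarrow> real"
  assume C: "has_copula \<Omega> U V (Cx (1 - 3 * m))"
  note law = has_copula_margins_and_integral[OF C facts(1-3) Cx]
  show "uniform01 \<Omega> U" by (rule law(1))
  show "uniform01 \<Omega> V" by (rule law(2))
  show "(\<integral>\<omega>. \<bar>U \<omega> - V \<omega>\<bar> \<partial>\<Omega>) = m"
    using law(3)[of "\<lambda>z. \<bar>fst z - snd z\<bar>"] facts(4) by simp
  show "(\<integral>\<omega>. (U \<omega> - V \<omega>)\<^sup>2 \<partial>\<Omega>) = m\<^sup>2 + Vmin m"
    using law(3)[of "\<lambda>z. (fst z - snd z)\<^sup>2"] facts(5) by simp
next
  show "is_copula comonotonicity_copula"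
    by (rule measure_is_copula[OF comonotone_measure(1-4)])
  fix \<Omega> :: "'a measure" and U V :: "'a \<Rightarrow> real"
  assume C: "has_copula \<Omega> U V comonotonicity_copula"
  note law = has_copula_margins_and_integral[OF C comonotone_measure(1-4)]
  show "uniform01 \<Omega> U" by (rule law(1))
  show "uniform01 \<Omega> V" by (rule law(2))
  have vanish: "(\<integral>z. g z \<partial>distr (uniform_measure lborel {0..1}) borel (\<lambda>x :: real. (x, x))) = 0"
    if "\<And>x. g (x, x) = 0" for g :: "real \<times> real \<Rightarrow> real"
    using comonotone_measure(5) that
    by (intro integral_eq_zero_AE) (auto elim!: eventually_mono)
  show "(\<integral>\<omega>. \<bar>U \<omega> - V \<omega>\<bar> \<partial>\<Omega>) = 0"
    using law(3)[of "\<lambda>z. \<bar>fst z - snd z\<bar>"] by (simp add: vanish)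
  show "(\<integral>\<omega>. (U \<omega> - V \<omega>)\<^sup>2 \<partial>\<Omega>) = 0\<^sup>2 + Vmin 0"
    using law(3)[of "\<lambda>z. (fst z - snd z)\<^sup>2"] by (simp add: vanish Vmin_zero)
next
  fix m :: real assume "m \<in> {0..1/2}"
  then show "0 \<le> Vmin m" "Vmin m = 0 \<longleftrightarrow> m \<in> crit_set"
    using Vmin_nonneg_and_zero_iff by blast+
qed

end
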